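(* Let $m>2$ be an integer, let $N$ be a Riemannian manifold and let $u:\mathbb{R}^m\to N$ be a smooth map satisfying $$\tau(u)=\tfrac12\, x\cdot \mathrm{d}u\quad\text{on }\mathbb{R}^m .$$ Then the following three conditions are equivalent to each other: (1) $\displaystyle \lim_{R\to\infty}R^{m}e^{-R^2/4}\int_{B_{R}(0)}e(u)e^{-|x|^2/4}\,\mathrm{d}x=0$; (2) $\displaystyle \int_{\mathbb{R}^m}|u_r|^2|x|^{4-m}\,\mathrm{d}x<\infty$; (3) $\displaystyle \int_{\mathbb{R}^m}e(u)e^{-|x|^2/4}\,\mathrm{d}x<\infty$.
   Context: $\mathbb{R}^m$ carries the Euclidean metric, and $B_R(0)$ is the open Euclidean ball of radius $R$ centered at $0$. $\tau(u)$ denotes the tension field of $u$ (with respect to the Euclidean metric on $\mathbb{R}^m$ and the metric of $N$), and $x\cdot \mathrm{d}u=\mathrm{d}u(x)=\sum_i x_i\,\partial_{x_i}u$, which equals $r u_r$ with $r=|x|$ and $u_r=\mathrm{d}u(\partial_r)$ the radial derivative. The energy density is $e(u)=\frac12|\mathrm{d}u|^2$. *)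

theory Defs
  imports "HOL-Analysis.Analysis"
begin

section \<open>Smooth functions on open sets\<close>

text \<open>\<open>C_on k S f\<close> is meant for open \<open>S\<close> and finite-dimensional domain: all iterated directional
  derivatives of order at most \<open>k\<close> exist and are continuous on \<open>S\<close>.\<close>

fun C_on :: "nat \<Rightarrow> 'a::real_normed_vector set \<Rightarrow> ('a \<Rightarrow> 'b::real_normed_vector) \<Rightarrow> bool" where
  "C_on 0 S f \<longleftrightarrow> continuous_on S f"
| "C_on (Suc k) S f \<longleftrightarrow>
     (\<forall>x\<in>S. f differentiable (at x)) \<and> (\<forall>v. C_on k S (\<lambda>x. frechet_derivative f (at x) v))"

definition smooth_on :: "'a::real_normed_vector set \<Rightarrow> ('a \<Rightarrow> 'b::real_normed_vector) \<Rightarrow> bool" where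
  "smooth_on S f \<longleftrightarrow> (\<forall>k. C_on k S f)"

definition partial_deriv :: "'m \<Rightarrow> (real^'m::finite \<Rightarrow> 'b::real_normed_vector) \<Rightarrow> real^'m \<Rightarrow> 'b" where
  "partial_deriv i f x = frechet_derivative f (at x) (axis i 1)"


section \<open>Riemannian manifolds\<close>

text \<open>A chart is a coordinate domain together with its coordinate map; values of the map outside the
  domain are irrelevant.\<close>

type_synonym ('p, 'n) chart = "'p set \<times> ('p \<Rightarrow> real^'n)"

text \<open>The metric is given by its component matrices: \<open>metric N c y $ i $ j\<close> is
  \<open>g(\<partial>\<^sub>i, \<partial>\<^sub>j)\<close>, with respect to the chart \<open>c\<close>, at the point having coordinates \<open>y\<close>.
  The atlas need not be maximal.\<close>

record ('p, 'n) riem_data =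
  space_top :: "'p topology"
  atlas :: "('p, 'n) chart set"
  metric :: "('p, 'n) chart \<Rightarrow> real^'n \<Rightarrow> real^'n^'n"

definition transition :: "('p, 'n::finite) chart \<Rightarrow> ('p, 'n) chart \<Rightarrow> real^'n \<Rightarrow> real^'n" where
  "transition c d = snd d \<circ> inv_into (fst c) (snd c)"

definition metric_form :: "('p, 'n::finite) riem_data \<Rightarrow> ('p, 'n) chart \<Rightarrow> real^'n \<Rightarrow> real^'n \<Rightarrow> real^'n \<Rightarrow> real"
  where "metric_form N c y v w = v \<bullet> (metric N c y *v w)"

definition smooth_manifold :: "('p, 'n::finite) riem_data \<Rightarrow> bool" where
  "smooth_manifold N \<longleftrightarrow>
     Hausdorff_space (space_top N) \<and> second_countable (space_top N) \<and>
     (\<Union>c\<in>atlas N. fst c) = topspace (space_top N) \<and>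
     (\<forall>c\<in>atlas N. openin (space_top N) (fst c) \<and> open (snd c ` fst c) \<and>
        homeomorphic_map (subtopology (space_top N) (fst c)) (top_of_set (snd c ` fst c)) (snd c)) \<and>
     (\<forall>c\<in>atlas N. \<forall>d\<in>atlas N. smooth_on (snd c ` (fst c \<inter> fst d)) (transition c d))"

text \<open>The last conjunct is the transformation law of a covariant 2-tensor under change of charts.\<close>

definition riemannian_manifold :: "('p, 'n::finite) riem_data \<Rightarrow> bool" where
  "riemannian_manifold N \<longleftrightarrow>
     smooth_manifold N \<and>
     (\<forall>c\<in>atlas N. smooth_on (snd c ` fst c) (metric N c)) \<and>
     (\<forall>c\<in>atlas N. \<forall>y\<in>snd c ` fst c.
        (\<forall>v w. metric_form N c y v w = metric_form N c y w v) \<and>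
        (\<forall>v. v \<noteq> 0 \<longrightarrow> metric_form N c y v v > 0)) \<and>
     (\<forall>c\<in>atlas N. \<forall>d\<in>atlas N. \<forall>p\<in>fst c \<inter> fst d. \<forall>v w.
        (let T = frechet_derivative (transition c d) (at (snd c p))
         in metric_form N c (snd c p) v w = metric_form N d (snd d p) (T v) (T w)))"

definition christoffel ::
  "('p, 'n::finite) riem_data \<Rightarrow> ('p, 'n) chart \<Rightarrow> 'n \<Rightarrow> 'n \<Rightarrow> 'n \<Rightarrow> real^'n \<Rightarrow> real" where
  "christoffel N c k i j y =
     1/2 * (\<Sum>l\<in>UNIV. matrix_inv (metric N c y) $ k $ l *
       (partial_deriv i (\<lambda>z. metric N c z $ j $ l) y
        + partial_deriv j (\<lambda>z. metric N c z $ i $ l) y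
        - partial_deriv l (\<lambda>z. metric N c z $ i $ j) y))"


section \<open>Maps from Euclidean space into a Riemannian manifold\<close>

definition smooth_map :: "('p, 'n::finite) riem_data \<Rightarrow> (real^'m::finite \<Rightarrow> 'p) \<Rightarrow> bool" where
  "smooth_map N u \<longleftrightarrow>
     continuous_map euclidean (space_top N) u \<and>
     (\<forall>c\<in>atlas N. smooth_on (u -` fst c) (snd c \<circ> u))"

text \<open>Tangent vectors at \<open>u x\<close> are represented by their components in a chart \<open>c\<close> around \<open>u x\<close>.
  \<open>differential c u x v\<close> represents \<open>du\<^sub>x(v)\<close>.\<close>

definition differential ::
  "('p, 'n::finite) chart \<Rightarrow> (real^'m::finite \<Rightarrow> 'p) \<Rightarrow> real^'m \<Rightarrow> real^'m \<Rightarrow> real^'n" where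
  "differential c u x v = frechet_derivative (snd c \<circ> u) (at x) v"

text \<open>Components of the trace of \<open>\<nabla>du\<close>, the domain being flat:
  \<open>\<tau>\<^sup>k = \<Delta>u\<^sup>k + \<Sum> \<Gamma>\<^sup>k\<^sub>i\<^sub>j(u) \<partial>\<^sub>a u\<^sup>i \<partial>\<^sub>a u\<^sup>j\<close>.\<close>

definition tension_field ::
  "('p, 'n::finite) riem_data \<Rightarrow> ('p, 'n) chart \<Rightarrow> (real^'m::finite \<Rightarrow> 'p) \<Rightarrow> real^'m \<Rightarrow> real^'n" where
  "tension_field N c u x = (\<chi> k. \<Sum>a\<in>UNIV.
     partial_deriv a (partial_deriv a (\<lambda>z. snd c (u z) $ k)) x
     + (\<Sum>i\<in>UNIV. \<Sum>j\<in>UNIV. christoffel N c k i j (snd c (u x))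
          * partial_deriv a (\<lambda>z. snd c (u z) $ i) x
          * partial_deriv a (\<lambda>z. snd c (u z) $ j) x))"

text \<open>\<open>|du\<^sub>x(v)|\<^sup>2\<close>, computed in some chart around \<open>u x\<close>; lemma \<open>sqnorm_differential_eq\<close> shows that
  the choice is immaterial.\<close>

definition sqnorm_differential ::
  "('p, 'n::finite) riem_data \<Rightarrow> (real^'m::finite \<Rightarrow> 'p) \<Rightarrow> real^'m \<Rightarrow> real^'m \<Rightarrow> real" where
  "sqnorm_differential N u x v =
     (let c = (SOME c. c \<in> atlas N \<and> u x \<in> fst c)
      in metric_form N c (snd c (u x)) (differential c u x v) (differential c u x v))"

definition energy_density :: "('p, 'n::finite) riem_data \<Rightarrow> (real^'m::finite \<Rightarrow> 'p) \<Rightarrow> real^'m \<Rightarrow> real" where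
  "energy_density N u x = 1/2 * (\<Sum>a\<in>UNIV. sqnorm_differential N u x (axis a 1))"

text \<open>\<open>|u\<^sub>r|\<^sup>2\<close>; the radial unit vector \<open>sgn x = x / norm x\<close> is \<open>0\<close> at the origin by convention.\<close>

definition sqnorm_radial :: "('p, 'n::finite) riem_data \<Rightarrow> (real^'m::finite \<Rightarrow> 'p) \<Rightarrow> real^'m \<Rightarrow> real" where
  "sqnorm_radial N u x = sqnorm_differential N u x (sgn x)"


section \<open>Independence of the chart\<close>

lemma smooth_on_differentiable: "smooth_on S f \<Longrightarrow> x \<in> S \<Longrightarrow> f differentiable (at x)"
  unfolding smooth_on_def by (metis C_on.simps(2))

lemma differential_change_chart:
  assumes M: "smooth_manifold N" and u: "smooth_map N u"
    and c: "c \<in> atlas N" "u x \<in> fst c" and d: "d \<in> atlas N" "u x \<in> fst d"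
  shows "differential d u x v =
    frechet_derivative (transition c d) (at (snd c (u x))) (differential c u x v)"
proof -
  have op: "openin (space_top N) (fst c)"
    and hm: "homeomorphic_map (subtopology (space_top N) (fst c)) (top_of_set (snd c ` fst c)) (snd c)"
    and sm: "smooth_on (snd c ` (fst c \<inter> fst d)) (transition c d)"
    using M c d unfolding smooth_manifold_def by blast+
  have inj: "inj_on (snd c) (fst c)"
    using homeomorphic_imp_injective_map[OF hm] openin_subset[OF op]
    by (simp add: Int_absorb1 Int_absorb2)
  have "openin euclidean {z \<in> topspace euclidean. u z \<in> fst c}"
    using u op unfolding smooth_map_def by (blast intro: openin_continuous_map_preimage)
  then have opn: "open (u -` fst c)"
    by (simp add: vimage_def)
  have eq: "(transition c d \<circ> (snd c \<circ> u)) z = (snd d \<circ> u) z" if "z \<in> u -` fst c" for z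
    using that inj by (simp add: transition_def)
  have dc: "(snd c \<circ> u) differentiable (at x)"
    using u c unfolding smooth_map_def by (auto intro: smooth_on_differentiable)
  have dt: "transition c d differentiable (at ((snd c \<circ> u) x))"
    using sm c d by (auto intro: smooth_on_differentiable)
  have "((transition c d \<circ> (snd c \<circ> u)) has_derivative
      frechet_derivative (transition c d) (at ((snd c \<circ> u) x)) \<circ> frechet_derivative (snd c \<circ> u) (at x)) (at x)"
    using dc dt by (intro diff_chain_at) (simp_all flip: frechet_derivative_works)
  then have "((snd d \<circ> u) has_derivative
      frechet_derivative (transition c d) (at ((snd c \<circ> u) x)) \<circ> frechet_derivative (snd c \<circ> u) (at x)) (at x)"
    by (rule has_derivative_transform_within_open[OF _ opn]) (use c eq in auto)
  then show ?thesis
    by (simp add: differential_def flip: frechet_derivative_at)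
qed

lemma sqnorm_differential_eq:
  assumes N: "riemannian_manifold N" and u: "smooth_map N u"
    and d: "d \<in> atlas N" "u x \<in> fst d"
  shows "sqnorm_differential N u x v =
    metric_form N d (snd d (u x)) (differential d u x v) (differential d u x v)"
proof -
  define c where "c = (SOME c. c \<in> atlas N \<and> u x \<in> fst c)"
  have c: "c \<in> atlas N" "u x \<in> fst c"
    using someI[of "\<lambda>c. c \<in> atlas N \<and> u x \<in> fst c" d] d unfolding c_def by auto
  have M: "smooth_manifold N"
    using N by (simp add: riemannian_manifold_def)
  have law: "\<forall>c\<in>atlas N. \<forall>d\<in>atlas N. \<forall>p\<in>fst c \<inter> fst d. \<forall>v w.
      (let T = frechet_derivative (transition c d) (at (snd c p))
       in metric_form N c (snd c p) v w = metric_form N d (snd d p) (T v) (T w))"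
    using N unfolding riemannian_manifold_def by (elim conjE)
  show ?thesis
    using law[rule_format, of c d "u x" "differential c u x v" "differential c u x v"] c d
    unfolding sqnorm_differential_def c_def[symmetric]
      differential_change_chart[OF M u c d] Let_def by blast
qed

end

theory Submission
  imports Defs "HOL-Real_Asymp.Real_Asymp"
begin

text \<open>
  Why the theorem holds. Write \<open>e\<close> for the energy density, \<open>\<beta>(x) = |du\<^sub>x(x)|\<^sup>2 = |x|\<^sup>2 |u\<^sub>r|\<^sup>2\<close>, and
  \<open>P\<^sub>i\<^sub>j = \<langle>\<partial>\<^sub>i u, \<partial>\<^sub>j u\<rangle>\<close> for the pulled-back metric. For any smooth map the stress-energy tensor
  \<open>S\<^sub>i\<^sub>j = e \<delta>\<^sub>i\<^sub>j - P\<^sub>i\<^sub>j\<close> has divergence \<open>- \<langle>\<tau>(u), \<partial>\<^sub>i u\<rangle>\<close>; with the equation for \<open>\<tau>(u)\<close> this is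
  \<open>- (1/2) \<Sum>\<^sub>j x\<^sub>j P\<^sub>i\<^sub>j\<close> (\<open>pullback_metric_divergence\<close>). Contracting \<open>S\<close> with the position vector gives a
  vector field \<open>W = e x - P(x, \<cdot>)\<close> with
  \<open>div W = (m - 2) e - \<beta>/2\<close> and \<open>x \<bullet> W = |x|\<^sup>2 e - \<beta>\<close>.

  The divergence theorem on balls turns this into one identity for functions of the radius. With
  \<open>p(r)\<close> and \<open>q(r)\<close> the integrals of \<open>e(r\<omega>)\<close> and \<open>\<beta>(r\<omega>)\<close> over the unit sphere, it says
  \<open>r\<^sup>m\<^sup>-\<^sup>1 (r\<^sup>2 p - q) = r \<integral>\<^sub>0\<^sup>r t\<^sup>m\<^sup>-\<^sup>1 ((m-2) p - q/2) dt\<close> (\<open>radial_flux_identity\<close>), and differentiating,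
  \<open>G' = (r/2 - (m-2)/r) q\<close> where \<open>G = q - r\<^sup>2 p\<close> (\<open>radial_defect_derivative\<close>). Let (1), (2), (3) denote the three
  conditions in the order of the theorem. In these terms (2) reads
  \<open>\<integral> r q dr < \<infinity>\<close>, (3) reads \<open>\<integral> r\<^sup>m\<^sup>-\<^sup>1 p exp(-r\<^sup>2/4) dr < \<infinity>\<close>, and (1) is the corresponding
  statement on the partial integrals of (3).

  The equivalence then follows from this equation for \<open>G\<close> and from the Cauchy-Schwarz bound
  \<open>0 \<le> q \<le> 2 r\<^sup>2 p\<close> (\<open>radial_energy_equivalence\<close>). For large \<open>r\<close> the function \<open>G\<close> increases.
  If \<open>G\<close> stays nonpositive there, it is bounded and the equation bounds \<open>\<integral> r q\<close>, which is (2). If it becomes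
  positive, then, because \<open>q \<ge> 2 G\<close>, it grows at least like \<open>r\<^sup>-\<^sup>2\<^sup>(\<^sup>m\<^sup>-\<^sup>2\<^sup>) exp(r\<^sup>2/2)\<close>; as \<open>r\<^sup>2 p \<ge> G\<close>, this forces the
  energy in (1) to grow at least like \<open>R\<^sup>-\<^sup>m exp(R\<^sup>2/4)\<close>, so (1) fails. Hence (1) implies (2). Conversely
  \<open>G\<close> is bounded below for large \<open>r\<close>, so \<open>r\<^sup>2 p \<le> q + C\<close> and (2) implies (3); and (3) implies (1) since
  \<open>R\<^sup>m exp(-R\<^sup>2/4)\<close> tends to \<open>0\<close>.
\<close>

section \<open>The radial differential equation\<close>

text \<open>Dividing the flux identity by \<open>R\<^sup>m\<^sup>-\<^sup>1\<close> writes \<open>q - R\<^sup>2 p\<close> as minus an integral over \<open>R\<^sup>m\<^sup>-\<^sup>2\<close>; on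
  differentiating, the two terms containing \<open>p\<close> cancel, so that only \<open>q\<close> drives the defect.\<close>

lemma radial_defect_derivative:
  fixes p q :: "real \<Rightarrow> real"
  assumes m: "m \<ge> 2"
    and cont: "continuous_on UNIV p" "continuous_on UNIV q"
    and flux: "\<And>R. R > 0 \<Longrightarrow> R^(m-1) * (R\<^sup>2 * p R - q R) =
        R * integral {0..R} (\<lambda>r. r^(m-1) * ((real m - 2) * p r - q r / 2))"
    and r: "r > 0"
  shows "((\<lambda>r. q r - r\<^sup>2 * p r) has_real_derivative (r/2 - (real m - 2)/r) * q r) (at r)"
proof -
  define g where "g r = r^(m-1) * ((real m - 2) * p r - q r / 2)" for r
  define J where "J R = integral {0..R} g" for R
  obtain n where n: "m = n + 2" using m by (metis add.commute le_Suc_ex)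
  have gc: "continuous_on S g" for S
    unfolding g_def by (intro continuous_intros continuous_on_subset[OF cont(1)] continuous_on_subset[OF cont(2)]) auto
  have eq: "q R - R\<^sup>2 * p R = - J R / R^n" if "R > 0" for R
  proof -
    have "R * (R^n * (R\<^sup>2 * p R - q R)) = R * J R"
      using flux[OF that] by (simp add: n J_def g_def[abs_def] mult_ac)
    then have "R^n * (R\<^sup>2 * p R - q R) = J R" using that by simp
    then show ?thesis using that by (auto simp: field_simps)
  qed
  have J': "(J has_real_derivative g r) (at r)"
  proof -
    have "(J has_real_derivative g r) (at r within {0..r+1})"
      unfolding J_def by (rule integral_has_real_derivative[OF gc]) (use r in auto)
    then show ?thesis
      using r by (simp add: at_within_Icc_at)
  qed
  have "((\<lambda>R. - J R / R^n) has_real_derivative (r/2 - (real m - 2)/r) * q r) (at r)"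
  proof -
    have 1: "((\<lambda>R. - J R / R^n) has_real_derivative (- g r * r^n + J r * (real n * r^(n-1))) / (r^n * r^n)) (at r)"
      by (rule derivative_eq_intros J' refl | use r in simp)+
    have Jr: "J r = - (q r - r\<^sup>2 * p r) * r^n"
      using eq[OF r] r by (simp add: field_simps)
    have "real n * r^(n-1) = real n * r^n / r"
      using r by (cases n) auto
    then have "(- g r * r^n + J r * (real n * r^(n-1))) / (r^n * r^n) = (- r * r^n * (real n * p r - q r / 2) * r^n 
         - (q r - r\<^sup>2 * p r) * r^n * (real n * r^n / r)) / (r^n * r^n)"
      unfolding Jr by (simp add: g_def n algebra_simps)
    also have "\<dots> = - r * (real n * p r - q r / 2) - (q r - r\<^sup>2 * p r) * (real n / r)"
      using r by (simp add: divide_simps) (simp add: algebra_simps)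
    also have "\<dots> = (r/2 - (real m - 2)/r) * q r"
      using r by (simp add: n field_simps power2_eq_square)
    finally show ?thesis using 1 by simp
  qed
  then show ?thesis
    by (rule has_field_derivative_transform_within_open[where S="{0<..}"]) (use eq r in auto)
qed

text \<open>A continuous function is integrable near \<open>0\<close>, so convergence over the half-line is decided by a majorant at infinity.\<close>

lemma nn_integral_halfline_finiteI:
  fixes f :: "real \<Rightarrow> real"
  assumes "continuous_on UNIV f"
    and g: "(\<integral>\<^sup>+ r. ennreal (g r) * indicator {a..} r \<partial>lborel) < \<infinity>"
    and le: "\<And>r. r \<ge> a \<Longrightarrow> f r \<le> g r"
  shows "(\<integral>\<^sup>+ r. ennreal (f r) * indicator {0..} r \<partial>lborel) < \<infinity>"
proof -
  have fm[measurable]: "f \<in> borel_measurable borel"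
    using assms(1) by (rule borel_measurable_continuous_onI)
  have "(\<integral>\<^sup>+ r. ennreal (f r) * indicator {0..} r \<partial>lborel) \<le>
     (\<integral>\<^sup>+ r. ennreal (f r) * indicator {0..a} r + ennreal (f r) * indicator {a..} r \<partial>lborel)"
    by (intro nn_integral_mono) (auto simp: indicator_def)
  also have "\<dots> = (\<integral>\<^sup>+ r. ennreal (f r) * indicator {0..a} r \<partial>lborel) + (\<integral>\<^sup>+ r. ennreal (f r) * indicator {a..} r \<partial>lborel)"
    by (intro nn_integral_add) auto
  also have "\<dots> < \<infinity>"
  proof -
    have "compact (f ` {0..a})"
      by (intro compact_continuous_image continuous_on_subset[OF assms(1)]) auto
    then obtain B where B: "\<And>r. r \<in> {0..a} \<Longrightarrow> \<bar>f r\<bar> \<le> B"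
      by (meson compact_imp_bounded bounded_real image_eqI)
    have "(\<integral>\<^sup>+ r. ennreal (f r) * indicator {0..a} r \<partial>lborel) \<le> (\<integral>\<^sup>+ r. ennreal B * indicator {0..a} r \<partial>lborel)"
      using B by (intro nn_integral_mono) (fastforce simp: indicator_def intro: ennreal_leI)
    also have "\<dots> < \<infinity>"
      by (subst nn_integral_cmult_indicator) (auto simp: ennreal_mult_less_top emeasure_lborel_Icc_eq)
    finally have 1: "(\<integral>\<^sup>+ r. ennreal (f r) * indicator {0..a} r \<partial>lborel) < \<infinity>" .
    have "(\<integral>\<^sup>+ r. ennreal (f r) * indicator {a..} r \<partial>lborel) \<le> (\<integral>\<^sup>+ r. ennreal (g r) * indicator {a..} r \<partial>lborel)"
      using le by (intro nn_integral_mono) (auto simp: indicator_def intro: ennreal_leI)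
    also note g
    finally show ?thesis using 1 by simp
  qed
  finally show ?thesis .
qed

text \<open>The one-dimensional core: here \<open>p\<close> and \<open>q\<close> are the spherical integrals of \<open>e\<close> and \<open>\<beta>\<close>, the flux identity
  is an ordinary differential equation for \<open>G = q - r\<^sup>2 p\<close>, and \<open>q \<le> 2 r\<^sup>2 p\<close> is equivalent to \<open>q \<ge> 2 G\<close>, which
  makes that equation, for large \<open>r\<close>, a differential inequality \<open>G' \<ge> 2 k G\<close>. The three implications are (1) to (2) by the
  growth alternative for \<open>G\<close>, (2) to (3) by the lower bound on \<open>G\<close>, and (3) to (1).\<close>

lemma radial_energy_equivalence:
  fixes p q :: "real \<Rightarrow> real" and m :: nat
  assumes m: "m > 2"
    and cont: "continuous_on UNIV p" "continuous_on UNIV q"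
    and nonneg: "\<And>r. r \<ge> 0 \<Longrightarrow> 0 \<le> p r" "\<And>r. r \<ge> 0 \<Longrightarrow> 0 \<le> q r"
    and le: "\<And>r. r \<ge> 0 \<Longrightarrow> q r \<le> 2 * r\<^sup>2 * p r"
    and flux: "\<And>R. R > 0 \<Longrightarrow> R^(m-1) * (R\<^sup>2 * p R - q R) =
        R * integral {0..R} (\<lambda>r. r^(m-1) * ((real m - 2) * p r - q r / 2))"
  defines "C1 \<equiv> ((\<lambda>R. R^m * exp (- R\<^sup>2/4) * integral {0..R} (\<lambda>r. r^(m-1) * p r * exp (- r\<^sup>2/4))) \<longlongrightarrow> 0) at_top"
    and "C2 \<equiv> (\<integral>\<^sup>+ r. ennreal (r * q r) * indicator {0..} r \<partial>lborel) < \<infinity>"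
    and "C3 \<equiv> (\<integral>\<^sup>+ r. ennreal (r^(m-1) * p r * exp (- r\<^sup>2/4)) * indicator {0..} r \<partial>lborel) < \<infinity>"
  shows "(C1 \<longleftrightarrow> C2) \<and> (C2 \<longleftrightarrow> C3)"
proof -
  define G where "G r = q r - r\<^sup>2 * p r" for r
  define k where "k r = r/2 - (real m - 2)/r" for r :: real
  \<comment> \<open>Beyond \<open>R0\<close> the coefficient \<open>k\<close> dominates \<open>r/4\<close>, since \<open>R0\<^sup>2 = 4 m\<^sup>2 \<ge> 4 (m - 2)\<close>.\<close>
  define R0 where "R0 = 2 * real m"
  define h where "h r = r^(m-1) * p r * exp (- r\<^sup>2/4)" for r
  define E where "E R = integral {0..R} h" for R
  have R0: "R0 > 1" using m by (simp add: R0_def)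
  have hc: "continuous_on S h" for S
    unfolding h_def by (intro continuous_intros continuous_on_subset[OF cont(1)]) auto
  have hnn: "r \<ge> 0 \<Longrightarrow> h r \<ge> 0" for r
    unfolding h_def using nonneg by auto
  have qm[measurable]: "q \<in> borel_measurable borel" and hm[measurable]: "h \<in> borel_measurable borel"
    using cont(2) hc by (auto intro: borel_measurable_continuous_onI)
  have km[measurable]: "k \<in> borel_measurable borel" unfolding k_def by measurable
  have G': "(G has_real_derivative k r * q r) (at r)" if "r > 0" for r
    unfolding G_def k_def using radial_defect_derivative[OF _ cont flux that] m by simp
  have k4: "k r \<ge> r/4" "k r \<ge> 0" if "r \<ge> R0" for r
  proof -
    have r: "r \<ge> 2 * real m" "r > 1" using that R0 by (auto simp: R0_def)
    have "4 * (real m - 2) \<le> 2 * real m * 2" using m by simp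
    also have "\<dots> \<le> r * r" using r m by (intro mult_mono) auto
    finally have "(real m - 2) / r \<le> r / 4" using r by (simp add: field_simps)
    then show "k r \<ge> r/4" by (simp add: k_def)
    then show "k r \<ge> 0" using r by simp
  qed
  have Gmono: "G r \<le> G s" if "R0 \<le> r" "r \<le> s" for r s
  proof (rule DERIV_nonneg_imp_nondecreasing[OF that(2)])
    fix x assume "r \<le> x" "x \<le> s"
    then show "\<exists>y. (G has_real_derivative y) (at x) \<and> 0 \<le> y"
      using G'[of x] k4[of x] nonneg(2)[of x] that R0 by (intro exI[of _ "k x * q x"]) auto
  qed
  \<comment> \<open>First alternative: an increasing function bounded above has a limit, so \<open>G' = k q \<ge> r q / 4\<close> is integrable.\<close>
  have bdd_imp_C2: C2 if bd: "\<And>r. r \<ge> R0 \<Longrightarrow> G r \<le> 0"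
  proof -
    obtain L where L: "(G \<longlongrightarrow> L) at_top"
    proof -
      have "(G \<longlongrightarrow> Sup (G ` {R0..})) at_top"
      proof (rule order_tendstoI)
        have bA: "bdd_above (G ` {R0..})" using bd by (auto intro!: bdd_aboveI2[of _ _ 0])
        fix a assume "a < Sup (G ` {R0..})"
        then obtain r where "r \<ge> R0" "a < G r"
          by (subst (asm) less_cSup_iff) (use bA in auto)
        then show "eventually (\<lambda>x. a < G x) at_top"
          using Gmono by (intro eventually_at_top_linorderI[of r]) (meson less_le_trans)
      next
        have bA: "bdd_above (G ` {R0..})" using bd by (auto intro!: bdd_aboveI2[of _ _ 0])
        fix a assume a: "Sup (G ` {R0..}) < a"
        show "eventually (\<lambda>x. G x < a) at_top"
          by (intro eventually_at_top_linorderI[of R0] le_less_trans[OF _ a] cSup_upper[OF _ bA]) auto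
      qed
      then show ?thesis using that by blast
    qed
    have "((\<lambda>r. 4 * G r) \<longlongrightarrow> 4 * L) at_top" by (intro tendsto_intros L)
    then have "(\<integral>\<^sup>+ r. ennreal (4 * (k r * q r)) * indicator {R0..} r \<partial>lborel) = 4 * L - 4 * G R0"
      using G' R0 k4 nonneg by (intro nn_integral_FTC_atLeast) (auto intro!: derivative_eq_intros)
    then have fin: "(\<integral>\<^sup>+ r. ennreal (4 * (k r * q r)) * indicator {R0..} r \<partial>lborel) < \<infinity>"
      by simp
    show C2 unfolding C2_def
    proof (rule nn_integral_halfline_finiteI[OF _ fin])
      show "continuous_on UNIV (\<lambda>r. r * q r)" by (intro continuous_intros cont)
      fix r assume r: "r \<ge> R0"
      have "r / 4 * q r \<le> k r * q r"
        using k4[OF r] nonneg(2)[of r] r R0 by (intro mult_right_mono) auto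
      then show "r * q r \<le> 4 * (k r * q r)" by simp
    qed
  qed
  have C12: C2 if C1
  proof (rule ccontr)
    assume "\<not> C2"
    with bdd_imp_C2 obtain R1 where R1: "R1 \<ge> R0" "G R1 > 0" by force
    \<comment> \<open>Second alternative: \<open>exp(-r\<^sup>2/2) r\<^sup>2\<^sup>(\<^sup>m\<^sup>-\<^sup>2\<^sup>)\<close> is the integrating factor for \<open>G' \<ge> 2 k G\<close>.\<close>
    define l where "l r = G r * (exp (- r\<^sup>2/2) * r^(2*(m-2)))" for r
    define c where "c = l R1"
    have R1p: "R1 > 0" using R1 R0 by simp
    have c: "c > 0" using R1 R1p by (simp add: c_def l_def)
    have lmono: "c \<le> l r" if "r \<ge> R1" for r
      unfolding c_def
    proof (rule DERIV_nonneg_imp_nondecreasing[OF that])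
      fix x assume x: "R1 \<le> x" "x \<le> r"
      then have xp: "x > 0" using R1p by simp
      have x1: "x^(2*(m-2) - 1) = x^(2*(m-2)) / x"
        using m xp by (subst power_diff) auto
      have "(l has_real_derivative (k x * q x) * (exp (- x\<^sup>2/2) * x^(2*(m-2)))
         + G x * ((exp (- x\<^sup>2/2) * (- x)) * x^(2*(m-2)) + exp (- x\<^sup>2/2) * (real (2*(m-2)) * x^(2*(m-2) - 1)))) (at x)"
        unfolding l_def by (rule derivative_eq_intros G'[OF xp] refl | simp)+
      also have "(k x * q x) * (exp (- x\<^sup>2/2) * x^(2*(m-2)))
         + G x * ((exp (- x\<^sup>2/2) * (- x)) * x^(2*(m-2)) + exp (- x\<^sup>2/2) * (real (2*(m-2)) * x^(2*(m-2) - 1)))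
         = exp (- x\<^sup>2/2) * x^(2*(m-2)) * k x * (q x - 2 * G x)"
        unfolding x1 k_def using m xp by (simp add: field_simps of_nat_diff)
      finally have *: "(l has_real_derivative exp (- x\<^sup>2/2) * x^(2*(m-2)) * k x * (q x - 2 * G x)) (at x)" .
      have "q x - 2 * G x \<ge> 0" using le[of x] xp by (simp add: G_def)
      then show "\<exists>y. (l has_real_derivative y) (at x) \<and> 0 \<le> y"
        using * k4[of x] x R1 xp by (intro exI[of _ "exp (- x\<^sup>2/2) * x^(2*(m-2)) * k x * (q x - 2 * G x)"]) auto
    qed
    have hlow: "h r \<ge> c * exp (r\<^sup>2/4) / r^(m-1)" if "r \<ge> R1" for r
    proof -
      have rp: "r > 0" using that R1p by simp
      have "c \<le> G r * (exp (- r\<^sup>2/2) * r^(2*(m-2)))" using lmono[OF that] by (simp add: l_def)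
      also have "\<dots> \<le> (r\<^sup>2 * p r) * (exp (- r\<^sup>2/2) * r^(2*(m-2)))"
        using le[of r] rp by (intro mult_right_mono) (auto simp: G_def mult_ac)
      finally have 1: "c * exp (r\<^sup>2/4) \<le> (r\<^sup>2 * p r) * (exp (- r\<^sup>2/2) * r^(2*(m-2))) * exp (r\<^sup>2/4)"
        by (simp add: mult_right_mono)
      have e: "exp (- r\<^sup>2/2) * exp (r\<^sup>2/4) = exp (- r\<^sup>2/4)"
        by (simp flip: exp_add)
      have "2*(m-2)+2 = (m-1)+(m-1)" using m by simp
      then have "r\<^sup>2 * r^(2*(m-2)) = r^(m-1) * r^(m-1)"
        by (metis power_add add.commute)
      then have "(r\<^sup>2 * p r) * (exp (- r\<^sup>2/2) * r^(2*(m-2))) * exp (r\<^sup>2/4) = h r * r^(m-1)"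
        unfolding h_def e[symmetric] by (simp add: mult_ac)
      then show ?thesis using 1 rp by (simp add: field_simps)
    qed
    \<comment> \<open>The lower bound on \<open>h\<close> is integrated in closed form after replacing \<open>r\<^sup>1\<^sup>-\<^sup>m\<close> by the smaller \<open>r R\<^sup>-\<^sup>m\<close>.\<close>
    have Elow: "R^m * exp (- R\<^sup>2/4) * E R \<ge> 2 * c * (1 - exp ((R1\<^sup>2 - R\<^sup>2)/4))" if R: "R \<ge> R1" for R
    proof -
      have Rp: "R > 0" using R R1p by simp
      have "((\<lambda>r. 2 * c * exp (r\<^sup>2/4) / R^m) has_vector_derivative (c * (r * exp (r\<^sup>2/4)) / R^m)) (at r within {R1..R})" for r
        using Rp by (auto intro!: derivative_eq_intros simp flip: has_real_derivative_iff_has_vector_derivative)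
      then have int: "((\<lambda>r. c * (r * exp (r\<^sup>2/4)) / R^m) has_integral 2 * c * exp (R\<^sup>2/4) / R^m - 2 * c * exp (R1\<^sup>2/4) / R^m) {R1..R}"
        by (intro fundamental_theorem_of_calculus R) auto
      have "2 * c * exp (R\<^sup>2/4) / R^m - 2 * c * exp (R1\<^sup>2/4) / R^m = integral {R1..R} (\<lambda>r. c * (r * exp (r\<^sup>2/4)) / R^m)"
        by (rule integral_unique[OF int, symmetric])
      also have "\<dots> \<le> integral {R1..R} h"
      proof (rule integral_le)
        show "(\<lambda>r. c * (r * exp (r\<^sup>2/4)) / R^m) integrable_on {R1..R}" using int by blast
        show "h integrable_on {R1..R}" by (intro integrable_continuous_interval hc)
        fix r assume r: "r \<in> {R1..R}"
        then have rp: "r > 0" using R1p by auto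
        have "r * r^(m-1) \<le> R^m"
          using r rp m by (simp add: power_mono flip: power_Suc)
        then have "c * (r * exp (r\<^sup>2/4)) / R^m \<le> c * exp (r\<^sup>2/4) / r^(m-1)"
          using c rp Rp by (simp add: field_simps)
        also have "\<dots> \<le> h r" using hlow r by auto
        finally show "c * (r * exp (r\<^sup>2/4)) / R^m \<le> h r" .
      qed
      also have "\<dots> \<le> E R"
        unfolding E_def using hnn R1p by (intro integral_subset_le integrable_continuous_interval hc) auto
      finally have "R^m * exp (- R\<^sup>2/4) * (2 * c * exp (R\<^sup>2/4) / R^m - 2 * c * exp (R1\<^sup>2/4) / R^m) \<le> R^m * exp (- R\<^sup>2/4) * E R"
        using Rp by (intro mult_left_mono) auto
      also have "R^m * exp (- R\<^sup>2/4) * (2 * c * exp (R\<^sup>2/4) / R^m - 2 * c * exp (R1\<^sup>2/4) / R^m) = 2 * c * (1 - exp ((R1\<^sup>2 - R\<^sup>2)/4))"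
      proof -
        have "R^m * exp (- R\<^sup>2/4) * (2 * c * exp (R\<^sup>2/4) / R^m - 2 * c * exp (R1\<^sup>2/4) / R^m)
            = 2 * c * (exp (- R\<^sup>2/4) * exp (R\<^sup>2/4) - exp (- R\<^sup>2/4) * exp (R1\<^sup>2/4))"
          using Rp by (simp add: right_diff_distrib)
        also have "exp (- R\<^sup>2/4) * exp (R\<^sup>2/4) = 1" by (simp flip: exp_add)
        also have "exp (- R\<^sup>2/4) * exp (R1\<^sup>2/4) = exp ((R1\<^sup>2 - R\<^sup>2)/4)"
          by (simp flip: exp_add add: diff_divide_distrib)
        finally show ?thesis .
      qed
      finally show ?thesis .
    qed
    have "((\<lambda>R. 2 * c * (1 - exp ((R1\<^sup>2 - R\<^sup>2)/4))) \<longlongrightarrow> 2 * c) at_top" by real_asymp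
    moreover have "((\<lambda>R. R^m * exp (- R\<^sup>2/4) * E R) \<longlongrightarrow> 0) at_top"
      using that unfolding C1_def E_def h_def by simp
    ultimately have "2 * c \<le> 0"
      by (intro tendsto_le[OF trivial_limit_at_top_linorder, where f="\<lambda>R. R^m * exp (- R\<^sup>2/4) * E R"])
         (use Elow in \<open>auto intro!: eventually_at_top_linorderI[of R1]\<close>)
    then show False using c by simp
  qed
  have C23: C3 if C2
  proof -
    define C where "C = \<bar>G R0\<bar>"
    have "((\<lambda>r::real. r^m * exp (- r\<^sup>2/4)) \<longlongrightarrow> 0) at_top" by real_asymp
    then have "eventually (\<lambda>r::real. r^m * exp (- r\<^sup>2/4) < 1) at_top"
      by (rule order_tendstoD) simp
    then obtain R2 where R2: "\<And>r::real. r \<ge> R2 \<Longrightarrow> r^m * exp (- r\<^sup>2/4) < 1"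
      by (auto simp: eventually_at_top_linorder)
    define R3 where "R3 = max R0 R2"
    have R3: "R3 > 1" using R0 by (simp add: R3_def)
    \<comment> \<open>From \<open>r\<^sup>2 p \<le> q + C\<close> and \<open>r\<^sup>m exp(-r\<^sup>2/4) < 1\<close> one gets \<open>h \<le> (q + C) / r\<^sup>3\<close>.\<close>
    have hup: "h r \<le> r * q r + C * r powr (-3)" if r: "r \<ge> R3" for r
    proof -
      have rp: "r > 1" "r \<ge> R0" using r R3 by (auto simp: R3_def)
      have "r\<^sup>2 * p r \<le> q r + C"
        using Gmono[of R0 r] rp by (simp add: G_def C_def)
      then have "r\<^sup>2 * p r * (r^m * exp (- r\<^sup>2/4)) \<le> (q r + C) * 1"
        using R2[of r] r rp nonneg(2)[of r] nonneg(1)[of r]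
        by (intro mult_mono) (auto simp: R3_def C_def)
      then have "r^3 * h r \<le> q r + C"
        using m rp unfolding h_def by (cases m) (auto simp: power2_eq_square power3_eq_cube mult_ac)
      then have "h r \<le> q r / r^3 + C / r^3" using rp by (simp add: field_simps)
      also have "q r / r^3 \<le> r * q r"
      proof -
        have "q r * 1 \<le> q r * (r * r^3)"
          using nonneg(2)[of r] rp by (intro mult_left_mono one_le_mult_iff mult_ge1_I one_le_power) auto
        then show ?thesis using rp by (simp add: field_simps)
      qed
      also have "C / r^3 = C * r powr (-3)" using rp by (simp add: powr_minus powr_numeral field_simps)
      finally show ?thesis by simp
    qed
    have "(\<integral>\<^sup>+ r. ennreal (C * r powr (-3)) * indicator {R3..} r \<partial>lborel) = 0 - (- C / 2 * R3 powr (-2))"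
    proof (rule nn_integral_FTC_atLeast)
      fix x assume "R3 \<le> x"
      then have "x > 0" using R3 by simp
      then show "((\<lambda>x. - C / 2 * x powr (-2)) has_real_derivative C * x powr (-3)) (at x)"
        by (auto intro!: derivative_eq_intros)
      show "0 \<le> C * x powr (-3)" by (simp add: C_def)
    next
      show "((\<lambda>x. - C / 2 * x powr (-2)) \<longlongrightarrow> 0) at_top" by real_asymp
    qed measurable
    then have 1: "(\<integral>\<^sup>+ r. ennreal (C * r powr (-3)) * indicator {R3..} r \<partial>lborel) < \<infinity>" by simp
    have "(\<integral>\<^sup>+ r. ennreal (r * q r) * indicator {R3..} r \<partial>lborel) \<le> (\<integral>\<^sup>+ r. ennreal (r * q r) * indicator {0..} r \<partial>lborel)"
      using R3 by (intro nn_integral_mono) (auto simp: indicator_def)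
    also have "\<dots> < \<infinity>" using that by (simp add: C2_def)
    finally have 2: "(\<integral>\<^sup>+ r. ennreal (r * q r) * indicator {R3..} r \<partial>lborel) < \<infinity>" .
    have "(\<integral>\<^sup>+ r. ennreal (r * q r + C * r powr (-3)) * indicator {R3..} r \<partial>lborel)
      = (\<integral>\<^sup>+ r. ennreal (r * q r) * indicator {R3..} r + ennreal (C * r powr (-3)) * indicator {R3..} r \<partial>lborel)"
      using R3 nonneg(2) by (intro nn_integral_cong) (auto simp: indicator_def C_def ennreal_plus)
    also have "\<dots> = (\<integral>\<^sup>+ r. ennreal (r * q r) * indicator {R3..} r \<partial>lborel) + (\<integral>\<^sup>+ r. ennreal (C * r powr (-3)) * indicator {R3..} r \<partial>lborel)"
      by (intro nn_integral_add) measurable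
    finally have "(\<integral>\<^sup>+ r. ennreal (r * q r + C * r powr (-3)) * indicator {R3..} r \<partial>lborel) < \<infinity>"
      using 1 2 by simp
    then have "(\<integral>\<^sup>+ r. ennreal (h r) * indicator {0..} r \<partial>lborel) < \<infinity>"
      by (rule nn_integral_halfline_finiteI[OF hc]) (use hup in auto)
    then show C3 by (simp add: C3_def h_def)
  qed
  have C31: C1 if C3
  proof -
    define L where "L = enn2real (\<integral>\<^sup>+ r. ennreal (h r) * indicator {0..} r \<partial>lborel)"
    have fin: "(\<integral>\<^sup>+ r. ennreal (h r) * indicator {0..} r \<partial>lborel) < \<infinity>"
      using that by (simp add: C3_def h_def)
    have EL: "0 \<le> E R \<and> E R \<le> L" if "R \<ge> 0" for R
    proof
      show "0 \<le> E R" unfolding E_def using hnn by (intro integral_nonneg integrable_continuous_interval hc) auto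
      have "((h has_integral E R) {0..R})"
        unfolding E_def by (intro integrable_integral integrable_continuous_interval hc)
      then have "ennreal (E R) = (\<integral>\<^sup>+ r. ennreal (h r) * indicator {0..R} r \<partial>lborel)"
        using hnn by (subst nn_integral_has_integral_lebesgue'[of "{0..R}" h "E R"]) auto
      also have "\<dots> \<le> (\<integral>\<^sup>+ r. ennreal (h r) * indicator {0..} r \<partial>lborel)"
        by (intro nn_integral_mono) (auto simp: indicator_def)
      also have "\<dots> = ennreal L" using fin by (simp add: L_def)
      finally show "E R \<le> L" by (simp add: L_def)
    qed
    have "((\<lambda>R. R^m * exp (- R\<^sup>2/4) * E R) \<longlongrightarrow> 0) at_top"
    proof (rule tendsto_sandwich)
      show "eventually (\<lambda>R. 0 \<le> R^m * exp (- R\<^sup>2/4) * E R) at_top"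
        using EL by (intro eventually_at_top_linorderI[of 0]) auto
      show "eventually (\<lambda>R. R^m * exp (- R\<^sup>2/4) * E R \<le> R^m * exp (- R\<^sup>2/4) * L) at_top"
        using EL by (intro eventually_at_top_linorderI[of 0] mult_left_mono) auto
      have "((\<lambda>R::real. R^m * exp (- R\<^sup>2/4)) \<longlongrightarrow> 0) at_top" by real_asymp
      then show "((\<lambda>R. R^m * exp (- R\<^sup>2/4) * L) \<longlongrightarrow> 0) at_top"
        by (rule tendsto_mult_left_zero)
    qed simp
    then show C1 unfolding C1_def E_def h_def .
  qed
  show ?thesis using C12 C23 C31 by blast
qed

section \<open>Continuously differentiable functions and polar coordinates\<close>

lemma C1_has_derivative:
  assumes "C_on 1 UNIV f" shows "(f has_derivative frechet_derivative f (at x)) (at x)"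
  using assms by (simp flip: frechet_derivative_works)

lemma C1_continuous: assumes "C_on 1 UNIV f" shows "continuous_on S f"
  by (rule has_derivative_continuous_on, rule has_derivative_at_withinI[OF C1_has_derivative[OF assms]])

text \<open>\<open>C_on\<close> only asks for continuity of each directional derivative; in finite dimension the direction may
  vary continuously as well, because it can be expanded in a basis.\<close>

lemma C1_derivative_continuous:
  fixes f :: "'a::euclidean_space \<Rightarrow> 'b::real_normed_vector"
  assumes "C_on 1 UNIV f" and "continuous_on S g" "continuous_on S h"
  shows "continuous_on S (\<lambda>x. frechet_derivative f (at (g x)) (h x))"
proof -
  have lin: "linear (frechet_derivative f (at x))" for x
    using C1_has_derivative[OF assms(1)] has_derivative_linear by blast
  have "frechet_derivative f (at (g x)) (h x) = (\<Sum>b\<in>Basis. (h x \<bullet> b) *\<^sub>R frechet_derivative f (at (g x)) b)" for x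
    by (subst euclidean_representation[symmetric, of "h x"])
       (simp add: linear_sum[OF lin] linear_scale[OF lin])
  moreover have "continuous_on S (\<lambda>x. frechet_derivative f (at (g x)) b)" for b
    using continuous_on_compose2[of UNIV "\<lambda>x. frechet_derivative f (at x) b" S g] assms by simp
  ultimately show ?thesis
    by (simp only:) (intro continuous_intros assms)
qed

lemma C1I:
  assumes "\<And>x. (f has_derivative f' x) (at x)" and "\<And>v. continuous_on UNIV (\<lambda>x. f' x v)"
  shows "C_on 1 UNIV f" "frechet_derivative f (at x) = f' x"
proof -
  have eq: "frechet_derivative f (at x) = f' x" for x
    using frechet_derivative_at[OF assms(1)] by simp
  then show "frechet_derivative f (at x) = f' x" .
  show "C_on 1 UNIV f" using assms by (auto simp: eq differentiable_def)
qed

lemma integrable_continuous_compact_support: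
  fixes f :: "'a::euclidean_space \<Rightarrow> real"
  assumes "continuous_on UNIV f" "\<And>x. norm x > R \<Longrightarrow> f x = 0"
  shows "integrable lborel f"
proof -
  have "integrable lborel (\<lambda>x. indicator (cball 0 R) x *\<^sub>R f x)"
    by (intro borel_integrable_compact compact_cball continuous_on_subset[OF assms(1)]) auto
  also have "(\<lambda>x. indicator (cball 0 R) x *\<^sub>R f x) = f"
    using assms(2) by (fastforce simp: indicator_def)
  finally show ?thesis .
qed

text \<open>The difference quotients of \<open>F\<close> integrate to \<open>0\<close> by translation invariance, and by the mean value
  theorem they are dominated by a multiple of the indicator of a ball, so the limit may be taken under the integral.\<close>

lemma integral_directional_derivative_eq_0:
  fixes F :: "'a::euclidean_space \<Rightarrow> real"
  assumes C1: "C_on 1 UNIV F" and supp: "\<And>x. norm x > R \<Longrightarrow> F x = 0"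
  shows "integrable lborel (\<lambda>x. frechet_derivative F (at x) v)"
    and "(LINT x|lborel. frechet_derivative F (at x) v) = 0"
proof -
  define d where "d x = frechet_derivative F (at x) v" for x
  have dc: "continuous_on UNIV d"
    unfolding d_def by (intro C1_derivative_continuous[OF C1] continuous_intros)
  have Fc: "continuous_on UNIV F" by (rule C1_continuous[OF C1])
  have d0: "d x = 0" if "norm x > R" for x
  proof -
    have "(F has_derivative (\<lambda>_. 0)) (at x)"
    proof (rule has_derivative_transform_within_open[of "\<lambda>_. 0" _ x UNIV "- cball 0 R"])
      show "((\<lambda>_. 0) has_derivative (\<lambda>_. 0)) (at x)" by simp
    qed (use that supp in auto)
    then show ?thesis unfolding d_def using frechet_derivative_at by metis
  qed
  show "integrable lborel (\<lambda>x. frechet_derivative F (at x) v)"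
    using integrable_continuous_compact_support[OF dc d0] by (simp add: d_def)
  have line: "((\<lambda>t. F (x + t *\<^sub>R v)) has_real_derivative d (x + t *\<^sub>R v)) (at t)" for x t
  proof -
    have "((\<lambda>t. F (x + t *\<^sub>R v)) has_derivative (\<lambda>s. frechet_derivative F (at (x + t *\<^sub>R v)) (s *\<^sub>R v))) (at t)"
      by (rule has_derivative_compose[OF _ C1_has_derivative[OF C1]]) (auto intro!: derivative_eq_intros)
    moreover have "frechet_derivative F (at (x + t *\<^sub>R v)) (s *\<^sub>R v) = d (x + t *\<^sub>R v) * s" for s
      using has_derivative_linear[OF C1_has_derivative[OF C1, of "x + t *\<^sub>R v"]]
      by (simp add: linear_scale d_def)
    ultimately show ?thesis by (simp add: has_field_derivative_def)
  qed
  obtain M where M: "\<And>x. \<bar>d x\<bar> \<le> M"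
  proof -
    have "compact (d ` cball 0 R)" by (intro compact_continuous_image continuous_on_subset[OF dc]) auto
    then obtain M where M: "\<And>x. x \<in> cball 0 R \<Longrightarrow> \<bar>d x\<bar> \<le> M"
      by (meson compact_imp_bounded bounded_real image_eqI)
    have "\<bar>d x\<bar> \<le> max M 0" for x
      using M[of x] d0[of x] by (cases "norm x \<le> R") auto
    then show ?thesis using that by blast
  qed
  define phi where "phi n x = (F (x + (1 / real (Suc n)) *\<^sub>R v) - F x) * real (Suc n)" for n x
  have Fi: "integrable lborel F" by (rule integrable_continuous_compact_support[OF Fc supp])
  have Fshift: "has_bochner_integral lborel (\<lambda>x. F (x + c)) (LINT x|lborel. F x)" for c
  proof -
    have [measurable]: "F \<in> borel_measurable borel" by (rule borel_measurable_continuous_onI[OF Fc])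
    have Fd: "integrable (distr lborel borel ((+) c)) F" "(LINT x|distr lborel borel ((+) c). F x) = (LINT x|lborel. F x)"
      using Fi by (simp_all add: lborel_distr_plus)
    have c: "(+) c \<in> lborel \<rightarrow>\<^sub>M borel" by measurable
    have "has_bochner_integral lborel (\<lambda>x. F (c + x)) (LINT x|lborel. F x)"
      using integrable_distr[OF c Fd(1)] integral_distr[OF c, of F] Fd(2) by (simp add: has_bochner_integral_iff)
    then show ?thesis by (simp only: add.commute[of c])
  qed
  have phi0: "(LINT x|lborel. phi n x) = 0" for n
    using Fshift[of "(1 / real (Suc n)) *\<^sub>R v"] Fi unfolding phi_def
    by (simp add: has_bochner_integral_iff del: of_nat_Suc)
  have "(\<lambda>n. LINT x|lborel. phi n x) \<longlonglongrightarrow> (LINT x|lborel. d x)"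
  proof (rule integral_dominated_convergence[where w="\<lambda>x. M * indicator (cball 0 (R + norm v)) x"])
    show "d \<in> borel_measurable lborel" using dc by (simp add: borel_measurable_continuous_onI)
    have [measurable]: "F \<in> borel_measurable borel" using Fc by (simp add: borel_measurable_continuous_onI)
    show "phi n \<in> borel_measurable lborel" for n unfolding phi_def by measurable
    show "integrable lborel (\<lambda>x. M * indicator (cball 0 (R + norm v)) x)"
      by (intro integrable_mult_right integrable_real_indicator) (auto simp: emeasure_lborel_cball_finite[simplified])
    show "AE x in lborel. (\<lambda>n. phi n x) \<longlonglongrightarrow> d x"
    proof (intro AE_I2)
      fix x
      have "((\<lambda>h. (F (x + h *\<^sub>R v) - F x) / h) \<longlongrightarrow> d x) (at 0)"
        using line[of x 0] by (simp add: DERIV_def)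
      moreover have "filterlim (\<lambda>n. 1 / real (Suc n)) (at 0) sequentially"
        using LIMSEQ_inverse_real_of_nat by (auto simp: filterlim_at inverse_eq_divide)
      ultimately have "(\<lambda>n. (F (x + (1 / real (Suc n)) *\<^sub>R v) - F x) / (1 / real (Suc n))) \<longlonglongrightarrow> d x"
        by (rule filterlim_compose)
      then show "(\<lambda>n. phi n x) \<longlonglongrightarrow> d x" by (simp add: phi_def)
    qed
    show "AE x in lborel. norm (phi n x) \<le> M * indicator (cball 0 (R + norm v)) x" for n
    proof (intro AE_I2)
      fix x
      let ?h = "1 / real (Suc n)"
      have h: "0 < ?h" "?h \<le> 1" by auto
      obtain z where "F (x + ?h *\<^sub>R v) - F (x + 0 *\<^sub>R v) = (?h - 0) * d (x + z *\<^sub>R v)"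
        using MVT2[OF h(1), of "\<lambda>t. F (x + t *\<^sub>R v)" "\<lambda>t. d (x + t *\<^sub>R v)"] line by blast
      then have eq: "phi n x = d (x + z *\<^sub>R v)" by (simp add: phi_def)
      show "norm (phi n x) \<le> M * indicator (cball 0 (R + norm v)) x"
      proof (cases "norm x \<le> R + norm v")
        case True then show ?thesis using M eq by simp
      next
        case False
        have "norm (?h *\<^sub>R v) \<le> norm v" using h(2) mult_right_mono[OF h(2), of "norm v"] by simp
        then have "norm (x + ?h *\<^sub>R v) > R"
          using norm_triangle_ineq2[of x "- (?h *\<^sub>R v)"] False by simp
        moreover have "norm x > R" using False norm_ge_zero[of v] by linarith
        ultimately show ?thesis using supp False by (simp add: phi_def)
      qed
    qed
  qed
  then show "(LINT x|lborel. frechet_derivative F (at x) v) = 0"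
    unfolding phi0 d_def using LIMSEQ_unique[OF tendsto_const] by metis
qed

text \<open>This is the integral of \<open>\<omega> \<mapsto> f (r \<omega>)\<close> over the unit sphere: the integrand is the divergence of the vector
  field \<open>y \<mapsto> f (r y) y\<close>, whose normal component on the sphere is \<open>f (r \<omega>)\<close>. The formula does not
  refer to surface measure and shows at once that the value depends continuously on \<open>r\<close>.\<close>

definition sphere_integral :: "('a::euclidean_space \<Rightarrow> real) \<Rightarrow> real \<Rightarrow> real" where
  "sphere_integral f r = (LINT y:cball 0 1|lborel.
     real DIM('a) * f (r *\<^sub>R y) + frechet_derivative f (at (r *\<^sub>R y)) (r *\<^sub>R y))"

lemma continuous_sphere_integral:
  fixes f :: "'a::euclidean_space \<Rightarrow> real"
  assumes C1: "C_on 1 UNIV f"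
  shows "continuous_on UNIV (sphere_integral f)"
proof -
  define K where "K z = real DIM('a) * f (fst z *\<^sub>R snd z) + frechet_derivative f (at (fst z *\<^sub>R snd z)) (fst z *\<^sub>R snd z)"
    for z :: "real \<times> 'a"
  have Kc: "continuous_on S K" for S
    unfolding K_def by (intro continuous_intros C1_derivative_continuous[OF C1] continuous_on_compose2[OF C1_continuous[OF C1, of UNIV]]) auto
  have K[measurable]: "(\<lambda>y. K (r, y)) \<in> borel_measurable borel" for r
    by (intro borel_measurable_continuous_onI continuous_on_compose2[OF Kc[of UNIV]] continuous_intros) auto
  have S: "sphere_integral f r = (LINT y|lborel. indicator (cball 0 1) y * K (r, y))" for r
    by (simp add: sphere_integral_def set_lebesgue_integral_def K_def)
  show ?thesis unfolding continuous_on_sequentially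
  proof safe
    fix x :: "nat \<Rightarrow> real" and a assume x: "x \<longlonglongrightarrow> a"
    then obtain B where B: "\<And>n. \<bar>x n\<bar> \<le> B"
      by (metis BseqE convergentI convergent_imp_Bseq real_norm_def)
    have "compact (K ` ({-B..B} \<times> cball 0 1))"
      by (intro compact_continuous_image Kc compact_Times) auto
    then obtain M where M: "\<And>z. z \<in> {-B..B} \<times> cball 0 1 \<Longrightarrow> \<bar>K z\<bar> \<le> M"
      by (meson compact_imp_bounded bounded_real image_eqI)
    have "(\<lambda>n. LINT y|lborel. indicator (cball 0 1) y * K (x n, y)) \<longlonglongrightarrow> (LINT y|lborel. indicator (cball 0 1) y * K (a, y))"
    proof (rule integral_dominated_convergence[where w="\<lambda>y. M * indicator (cball 0 1) y"])
      show "integrable lborel (\<lambda>x. M * indicator (cball 0 1) (x::'a))"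
        by (intro integrable_mult_right integrable_real_indicator) (auto simp: emeasure_lborel_cball_finite[simplified])
      show "AE y in lborel. (\<lambda>n. indicator (cball 0 1) y * K (x n, y)) \<longlonglongrightarrow> indicator (cball 0 1) y * K (a, y)"
        using x by (intro AE_I2 tendsto_intros continuous_on_tendsto_compose[OF Kc[of UNIV]]) auto
      show "AE y in lborel. norm (indicator (cball 0 1) y * K (x n, y)) \<le> M * indicator (cball 0 1) y" for n
      proof (intro AE_I2)
        fix y
        have "x n \<in> {-B..B}" using B[of n] by auto
        then show "norm (indicator (cball 0 1) y * K (x n, y)) \<le> M * indicator (cball 0 1) y"
          using M[of "(x n, y)"] by (auto simp: indicator_def)
      qed
    qed (auto intro!: borel_measurable_times borel_measurable_indicator K)
    then show "(sphere_integral f \<circ> x) \<longlonglongrightarrow> sphere_integral f a"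
      by (simp add: o_def S)
  qed
qed

text \<open>Polar coordinates by Fubini: \<open>r\<^sup>m\<^sup>-\<^sup>1\<close> times the integrand of \<open>sphere_integral\<close> is the \<open>r\<close>-derivative of
  \<open>r\<^sup>m f (r y)\<close>, so integrating first in \<open>r\<close> leaves \<open>R\<^sup>m f (R y)\<close>, whose integral over the unit ball is the
  integral of \<open>f\<close> over the ball of radius \<open>R\<close>.\<close>

lemma integral_cball_eq_integral_spheres:
  fixes f :: "'a::euclidean_space \<Rightarrow> real"
  assumes C1: "C_on 1 UNIV f" and R: "R > 0"
  shows "(LINT x:cball 0 R|lborel. f x) = integral {0..R} (\<lambda>r. r^(DIM('a)-1) * sphere_integral f r)"
proof -
  let ?m = "DIM('a)"
  obtain n where n: "?m = Suc n" using DIM_positive[where 'a='a] not0_implies_Suc by blast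
  define K where "K r y = r^(?m-1) * (real ?m * f (r *\<^sub>R y) + frechet_derivative f (at (r *\<^sub>R y)) (r *\<^sub>R y))"
    for r and y :: 'a
  have fc: "continuous_on S f" for S by (rule C1_continuous[OF C1])
  have Kc: "continuous_on S (\<lambda>z. K (fst z) (snd z))" for S
    unfolding K_def by (intro continuous_intros C1_derivative_continuous[OF C1] continuous_on_compose2[OF fc[of UNIV]]) auto
  have Krc: "continuous_on S (\<lambda>r. K r y)" for S y
  proof -
    have "continuous_on S (\<lambda>r. (r, y))" by (intro continuous_intros)
    then show ?thesis using continuous_on_compose2[OF Kc[of UNIV]] by fastforce
  qed
  have radial: "((\<lambda>r. K r y) has_integral R^?m * f (R *\<^sub>R y)) {0..R}" for y
  proof -
    have "((\<lambda>r. r^?m * f (r *\<^sub>R y)) has_real_derivative K r y) (at r)" for r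
    proof -
      have "((\<lambda>r. f (r *\<^sub>R y)) has_derivative (\<lambda>s. frechet_derivative f (at (r *\<^sub>R y)) (s *\<^sub>R y))) (at r)"
        by (rule has_derivative_compose[OF _ C1_has_derivative[OF C1]]) (auto intro!: derivative_eq_intros)
      moreover have lin: "frechet_derivative f (at (r *\<^sub>R y)) (s *\<^sub>R y) = s * frechet_derivative f (at (r *\<^sub>R y)) y" for s
        using has_derivative_linear[OF C1_has_derivative[OF C1, of "r *\<^sub>R y"]]
        by (simp add: linear_scale)
      ultimately have 1: "((\<lambda>r. f (r *\<^sub>R y)) has_real_derivative frechet_derivative f (at (r *\<^sub>R y)) y) (at r)"
        by (simp add: has_field_derivative_def mult.commute[of _ "frechet_derivative f (at (r *\<^sub>R y)) y"])
      show ?thesis unfolding K_def lin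
        by (rule derivative_eq_intros 1 refl)+ (simp add: n algebra_simps)
    qed
    then have "((\<lambda>r. K r y) has_integral (R^?m * f (R *\<^sub>R y) - 0^?m * f (0 *\<^sub>R y))) {0..R}"
      using R by (intro fundamental_theorem_of_calculus)
        (auto simp flip: has_real_derivative_iff_has_vector_derivative intro: has_field_derivative_at_within)
    then show ?thesis by (simp add: n)
  qed
  have Ki: "integrable (lborel \<Otimes>\<^sub>M lborel) (\<lambda>(r, y). indicator {0..R} r * (indicator (cball 0 1) y * K r y))"
  proof -
    have "integrable lborel (\<lambda>z. indicator ({0..R} \<times> cball 0 1) z *\<^sub>R K (fst z) (snd z))"
      by (intro borel_integrable_compact compact_Times Kc) auto
    then show ?thesis
      by (simp add: lborel_prod split_beta' indicator_times mult.assoc)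
  qed
  have inner1: "(LINT r|lborel. indicator {0..R} r * (indicator (cball 0 1) y * K r y)) = indicator (cball 0 1) y * (R^?m * f (R *\<^sub>R y))" for y
  proof -
    have "(LINT r:{0..R}|lborel. K r y) = R^?m * f (R *\<^sub>R y)"
      using set_borel_integral_eq_integral(2)[OF borel_integrable_atLeastAtMost'[OF Krc]] radial[of y]
      by (simp add: integral_unique)
    then show ?thesis by (simp add: set_lebesgue_integral_def mult.left_commute[of "indicator {0..R} _"])
  qed
  have inner2: "(LINT y|lborel. indicator {0..R} r * (indicator (cball 0 1) y * K r y)) = indicator {0..R} r * (r^(?m-1) * sphere_integral f r)" for r
    by (simp add: sphere_integral_def set_lebesgue_integral_def K_def mult.left_commute[of "indicator (cball 0 1) _"])
  have "(LINT x:cball 0 R|lborel. f x) = (LINT y:cball 0 1|lborel. R^?m * f (R *\<^sub>R y))"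
  proof -
    have "(LINT x:cball 0 R|lborel. f x) = (LINT x|density (distr lborel borel (\<lambda>x. 0 + R *\<^sub>R x)) (\<lambda>_. \<bar>R\<bar>^?m). indicator (cball 0 R) x *\<^sub>R f x)"
      unfolding set_lebesgue_integral_def using R by (subst lborel_affine[of R 0]) auto
    also have "\<dots> = (LINT x|lborel. R^?m * (indicator (cball 0 R) (R *\<^sub>R x) * f (R *\<^sub>R x)))"
    proof -
      have [measurable]: "f \<in> borel_measurable borel" by (rule borel_measurable_continuous_onI[OF fc])
      have "(LINT x|distr lborel borel (\<lambda>x. 0 + R *\<^sub>R x). R^?m * (indicator (cball 0 R) x * f x))
          = (LINT x|lborel. R^?m * (indicator (cball 0 R) (R *\<^sub>R x) * f (R *\<^sub>R x)))"
        by (subst integral_distr) (auto intro!: borel_measurable_times borel_measurable_indicator)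
      then show ?thesis
        using R by (subst integral_density) (auto intro!: borel_measurable_times borel_measurable_indicator)
    qed
    also have "\<dots> = (LINT x|lborel. R^?m * (indicator (cball 0 1) x * f (R *\<^sub>R x)))"
    proof -
      have "indicator (cball 0 R) (R *\<^sub>R x) = (indicator (cball 0 1) x :: real)" for x :: 'a
        using R by (auto simp: indicator_def)
      then show ?thesis by simp
    qed
    finally show ?thesis by (simp add: set_lebesgue_integral_def mult.left_commute[of "indicat_real (cball 0 1) _"])
  qed
  also have "\<dots> = (LINT y|lborel. LINT r|lborel. indicator {0..R} r * (indicator (cball 0 1) y * K r y))"
    by (simp only: inner1 set_lebesgue_integral_def real_scaleR_def)
  also have "\<dots> = (LINT r|lborel. LINT y|lborel. indicator {0..R} r * (indicator (cball 0 1) y * K r y))"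
    by (rule lborel_pair.Fubini_integral[OF Ki])
  also have "\<dots> = (LINT r:{0..R}|lborel. r^(?m-1) * sphere_integral f r)"
    by (simp only: inner2 set_lebesgue_integral_def real_scaleR_def)
  also have "\<dots> = integral {0..R} (\<lambda>r. r^(?m-1) * sphere_integral f r)"
    by (intro set_borel_integral_eq_integral(2) borel_integrable_atLeastAtMost' continuous_intros
        continuous_on_subset[OF continuous_sphere_integral[OF C1]]) auto
  finally show ?thesis .
qed

lemma integrand_nonneg_if_integral_mono:
  fixes g :: "real \<Rightarrow> real"
  assumes g: "continuous_on UNIV g"
    and mono: "\<And>r s. 0 < r \<Longrightarrow> r \<le> s \<Longrightarrow> integral {0..r} g \<le> integral {0..s} g"
    and r: "r > 0"
  shows "g r \<ge> 0"
proof (rule ccontr)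
  assume "\<not> g r \<ge> 0"
  have "((\<lambda>R. integral {0..R} g) has_real_derivative g r) (at r within {0..r+1})"
    by (rule integral_has_real_derivative) (use r g in \<open>auto intro: continuous_on_subset\<close>)
  then have "((\<lambda>R. integral {0..R} g) has_real_derivative g r) (at r)"
    using r by (simp add: at_within_Icc_at)
  then obtain d where d: "d > 0" "\<And>h. h > 0 \<Longrightarrow> h < d \<Longrightarrow> integral {0..r+h} g < integral {0..r} g"
    using DERIV_neg_dec_right[of _ "g r" r] \<open>\<not> g r \<ge> 0\<close> by auto
  have "integral {0..r + d/2} g < integral {0..r} g" by (rule d(2)) (use d(1) in auto)
  moreover have "integral {0..r} g \<le> integral {0..r + d/2} g" by (rule mono) (use d(1) r in auto)
  ultimately show False by linarith
qed

lemma nonneg_on_halfline_if_nonneg_pos: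
  fixes g :: "real \<Rightarrow> real"
  assumes "continuous_on UNIV g" "\<And>r. r > 0 \<Longrightarrow> g r \<ge> 0" "r \<ge> 0"
  shows "g r \<ge> 0"
proof -
  have "((\<lambda>x. g x) \<longlongrightarrow> g r) (at_right r)"
    using assms(1) by (auto simp: continuous_on_def intro: tendsto_within_subset)
  then show ?thesis
    by (rule tendsto_lowerbound) (use assms in \<open>auto simp: eventually_at_right[of r "r+1"] intro!: exI[of _ "r+1"]\<close>)
qed

lemma sphere_integral_nonneg:
  fixes f :: "'a::euclidean_space \<Rightarrow> real"
  assumes C1: "C_on 1 UNIV f" and nn: "\<And>x. f x \<ge> 0" and r: "r \<ge> 0"
  shows "sphere_integral f r \<ge> 0"
proof (rule nonneg_on_halfline_if_nonneg_pos[OF continuous_sphere_integral[OF C1] _ r])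
  fix r :: real assume r: "r > 0"
  have "r^(DIM('a)-1) * sphere_integral f r \<ge> 0"
  proof (rule integrand_nonneg_if_integral_mono[OF _ _ r])
    show "continuous_on UNIV (\<lambda>r. r^(DIM('a)-1) * sphere_integral f r)"
      by (intro continuous_intros continuous_sphere_integral[OF C1])
    fix r s :: real assume rs: "0 < r" "r \<le> s"
    have "set_integrable lborel (cball 0 s) f" for s
      unfolding set_integrable_def by (intro borel_integrable_compact compact_cball C1_continuous[OF C1])
    then have "(LINT x:cball 0 r|lborel. f x) \<le> (LINT x:cball 0 s|lborel. f x)"
      unfolding set_lebesgue_integral_def set_integrable_def
      by (intro integral_mono) (use rs nn in \<open>auto simp: indicator_def\<close>)
    then show "integral {0..r} (\<lambda>r. r^(DIM('a)-1) * sphere_integral f r) \<le> integral {0..s} (\<lambda>r. r^(DIM('a)-1) * sphere_integral f r)"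
      using rs by (simp add: integral_cball_eq_integral_spheres[OF C1])
  qed
  then show "sphere_integral f r \<ge> 0"
    using r by (metis linorder_not_le mult_pos_neg zero_less_power)
qed

text \<open>Polar coordinates for an arbitrary measurable radial weight: the image of the measure \<open>f dx\<close> under \<open>norm\<close>
  has density \<open>r\<^sup>m\<^sup>-\<^sup>1 sphere_integral f r\<close>, because the two measures agree on the sets \<open>{..R}\<close>.\<close>

lemma nn_integral_polar:
  fixes f :: "'a::euclidean_space \<Rightarrow> real"
  assumes C1: "C_on 1 UNIV f" and nn: "\<And>x. f x \<ge> 0" and h[measurable]: "h \<in> borel_measurable borel"
  shows "(\<integral>\<^sup>+ x. h (norm x) * ennreal (f x) \<partial>lborel) =
     (\<integral>\<^sup>+ r. h r * (ennreal (r^(DIM('a)-1) * sphere_integral f r) * indicator {0..} r) \<partial>lborel)"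
proof -
  define a where "a r = r^(DIM('a)-1) * sphere_integral f r" for r
  have fc: "continuous_on S f" for S by (rule C1_continuous[OF C1])
  have fm[measurable]: "f \<in> borel_measurable borel" by (rule borel_measurable_continuous_onI[OF fc])
  have ac: "continuous_on S a" for S unfolding a_def
    by (intro continuous_intros continuous_on_subset[OF continuous_sphere_integral[OF C1]]) auto
  have am[measurable]: "a \<in> borel_measurable borel" by (rule borel_measurable_continuous_onI[OF ac])
  have ann: "r \<ge> 0 \<Longrightarrow> a r \<ge> 0" for r
    unfolding a_def using sphere_integral_nonneg[OF C1 nn] by auto
  define M where "M = distr (density lborel (\<lambda>x. ennreal (f x))) borel norm"
  define N where "N = density lborel (\<lambda>r. ennreal (a r) * indicator {0..} r)"
  have M: "emeasure M {..R} = (\<integral>\<^sup>+ x. ennreal (f x) * indicator (cball 0 R) x \<partial>lborel)" for R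
    unfolding M_def by (subst emeasure_distr) (auto simp: emeasure_density vimage_def cball_def intro!: nn_integral_cong split: split_indicator)
  have fi: "integrable lborel (\<lambda>x. indicator (cball 0 R) x *\<^sub>R f x)" for R
    by (intro borel_integrable_compact compact_cball fc)
  have M': "emeasure M {..R} = ennreal (LINT x:cball 0 R|lborel. f x)" for R
    unfolding M set_lebesgue_integral_def using nn
    by (subst nn_integral_eq_integral[OF fi, symmetric]) (auto intro!: nn_integral_cong split: split_indicator)
  have eq: "emeasure M {..R} = emeasure N {..R}" for R
  proof (cases "R > 0")
    case True
    have "((a has_integral integral {0..R} a) {0..R})"
      by (intro integrable_integral integrable_continuous_interval ac)
    then have "(\<integral>\<^sup>+ r. ennreal (a r) * indicator {0..R} r \<partial>lborel) = ennreal (integral {0..R} a)"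
      using ann by (intro nn_integral_has_integral_lebesgue') auto
    moreover have "emeasure N {..R} = (\<integral>\<^sup>+ r. ennreal (a r) * indicator {0..R} r \<partial>lborel)"
      unfolding N_def by (subst emeasure_density) (auto intro!: nn_integral_cong split: split_indicator)
    ultimately show ?thesis
      using integral_cball_eq_integral_spheres[OF C1 True] M' by (simp add: a_def[abs_def])
  next
    case False
    have "cball 0 R \<subseteq> {0::'a}" 
    proof
      fix x :: 'a assume "x \<in> cball 0 R"
      then have "norm x \<le> R" by simp
      with False have "norm x \<le> 0" by linarith
      then show "x \<in> {0}" by simp
    qed
    then have "emeasure M {..R} \<le> (\<integral>\<^sup>+ x. ennreal (f x) * indicator {0} x \<partial>lborel)"
      unfolding M by (intro nn_integral_mono) (auto split: split_indicator)
    also have "\<dots> = 0" by (subst nn_integral_null_set) auto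
    finally have 1: "emeasure M {..R} = 0" by simp
    have "emeasure N {..R} = (\<integral>\<^sup>+ r. ennreal (a r) * indicator {0..} r * indicator {..R} r \<partial>lborel)"
      unfolding N_def by (rule emeasure_density) auto
    also have "\<dots> \<le> (\<integral>\<^sup>+ r. ennreal (a r) * indicator {0} r \<partial>lborel)"
      using False by (intro nn_integral_mono) (auto split: split_indicator)
    also have "\<dots> = 0" by (subst nn_integral_null_set) auto
    finally show ?thesis using 1 by simp
  qed
  have "M = N"
  proof (rule measure_eqI_generator_eq[where E="range atMost" and \<Omega>=UNIV and A="\<lambda>n. {..real n}"])
    show "Int_stable (range (atMost :: real \<Rightarrow> _))" by (auto simp: Int_stable_def)
    show "sets M = sigma_sets UNIV (range atMost)" "sets N = sigma_sets UNIV (range atMost)"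
      by (simp_all add: M_def N_def borel_eq_atMost)
    show "(\<Union>i. {..real i}) = UNIV" by (auto intro: real_arch_simple)
    show "emeasure M {..real i} \<noteq> \<infinity>" for i by (simp add: M')
  qed (auto simp: eq)
  have "(\<integral>\<^sup>+ x. h (norm x) * ennreal (f x) \<partial>lborel) = (\<integral>\<^sup>+ r. h r \<partial>M)"
    unfolding M_def by (subst nn_integral_distr) (auto simp: nn_integral_density mult.commute)
  also have "\<dots> = (\<integral>\<^sup>+ r. h r * (ennreal (a r) * indicator {0..} r) \<partial>lborel)"
    unfolding \<open>M = N\<close> N_def by (subst nn_integral_density) (auto simp: mult.commute)
  finally show ?thesis by (simp add: a_def)
qed

text \<open>The set \<open>S\<close> may be the open or the closed ball; they differ by a sphere, which is a null set.\<close>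

lemma integral_polar:
  fixes f :: "'a::euclidean_space \<Rightarrow> real"
  assumes C1: "C_on 1 UNIV f" and nn: "\<And>x. f x \<ge> 0"
    and w: "continuous_on UNIV w" "\<And>r. 0 \<le> r \<Longrightarrow> r \<le> R \<Longrightarrow> w r \<ge> 0" and R: "R \<ge> 0"
    and S: "ball 0 R \<subseteq> S" "S \<subseteq> cball 0 R" "S \<in> sets borel"
  shows "has_bochner_integral lborel (\<lambda>x. indicator S x * (w (norm x) * f x))
      (integral {0..R} (\<lambda>r. w r * (r^(DIM('a)-1) * sphere_integral f r)))"
proof -
  define a where "a r = r^(DIM('a)-1) * sphere_integral f r" for r
  have fc: "continuous_on S f" for S by (rule C1_continuous[OF C1])
  have fm[measurable]: "f \<in> borel_measurable borel" by (rule borel_measurable_continuous_onI[OF fc])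
  have wm[measurable]: "w \<in> borel_measurable borel" by (rule borel_measurable_continuous_onI[OF w(1)])
  have ac: "continuous_on S a" for S unfolding a_def
    by (intro continuous_intros continuous_on_subset[OF continuous_sphere_integral[OF C1]]) auto
  have wac: "continuous_on S (\<lambda>r. w r * a r)" for S
    by (intro continuous_intros ac continuous_on_subset[OF w(1)]) auto
  have ann: "r \<ge> 0 \<Longrightarrow> a r \<ge> 0" for r
    unfolding a_def using sphere_integral_nonneg[OF C1 nn] by auto
  have nul: "sphere (0::'a) R \<in> null_sets lborel"
    using negligible_sphere[of "0::'a" R] by (simp add: negligible_iff_null_sets null_sets_completion_iff)
  then have AE: "AE x in lborel. x \<notin> sphere (0::'a) R" by (rule AE_not_in)
  have "(\<integral>\<^sup>+ x. ennreal (indicator S x * (w (norm x) * f x)) \<partial>lborel)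
     = (\<integral>\<^sup>+ x. (ennreal (w (norm x)) * indicator {0..R} (norm x)) * ennreal (f x) \<partial>lborel)"
  proof (rule nn_integral_cong_AE, use AE in eventually_elim)
    case (elim x)
    then have "x \<in> S \<longleftrightarrow> norm x \<in> {0..R}"
      using subsetD[OF S(1), of x] subsetD[OF S(2), of x] by (simp add: order_less_le) blast
    then show ?case using w(2)[of "norm x"] nn[of x]
      by (cases "x \<in> S") (simp_all add: ennreal_mult)
  qed
  also have "\<dots> = (\<integral>\<^sup>+ r. (ennreal (w r) * indicator {0..R} r) * (ennreal (a r) * indicator {0..} r) \<partial>lborel)"
    unfolding a_def by (rule nn_integral_polar[OF C1 nn]) measurable
  also have "\<dots> = (\<integral>\<^sup>+ r. ennreal (w r * a r) * indicator {0..R} r \<partial>lborel)"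
    using w ann by (intro nn_integral_cong) (simp add: ennreal_mult split: split_indicator)
  also have "\<dots> = ennreal (integral {0..R} (\<lambda>r. w r * a r))"
    using w ann by (intro nn_integral_has_integral_lebesgue' integrable_integral integrable_continuous_interval wac) auto
  finally have eq: "(\<integral>\<^sup>+ x. ennreal (indicator S x * (w (norm x) * f x)) \<partial>lborel)
     = ennreal (integral {0..R} (\<lambda>r. w r * a r))" .
  show ?thesis unfolding a_def[symmetric]
  proof (rule has_bochner_integral_nn_integral[OF _ _ _ eq])
    show "(\<lambda>x. indicator S x * (w (norm x) * f x)) \<in> borel_measurable lborel"
      using S(3) by measurable
    have "x \<in> S \<Longrightarrow> norm x \<le> R" for x using subsetD[OF S(2), of x] by simp
    then show "AE x in lborel. 0 \<le> indicator S x * (w (norm x) * f x)"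
      using w(2) nn by (intro AE_I2) (simp split: split_indicator)
    show "0 \<le> integral {0..R} (\<lambda>r. w r * a r)"
      using w(2) ann by (intro integral_nonneg integrable_continuous_interval wac) simp
  qed
qed


section \<open>The divergence theorem with a radial cutoff\<close>

text \<open>Recovers the divergence theorem on a sharp ball from its version with the cutoff
  \<open>(R\<^sup>2 - r\<^sup>2)\<^sup>2\<close>: the cutoff vanishes to second order at \<open>r = R\<close>, so two differentiations in \<open>R\<close> remove it.\<close>

lemma flux_from_cutoff_moments:
  fixes g h :: "real \<Rightarrow> real"
  assumes g: "continuous_on UNIV g" and h: "continuous_on UNIV h"
    and eq: "\<And>R. R > 0 \<Longrightarrow> integral {0..R} (\<lambda>r. (R\<^sup>2 - r\<^sup>2)\<^sup>2 * g r) = 4 * integral {0..R} (\<lambda>r. (R\<^sup>2 - r\<^sup>2) * h r)"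
    and R: "R > 0"
  shows "h R = R * integral {0..R} g"
proof -
  have I: "((\<lambda>R. integral {0..R} k) has_real_derivative k r) (at r)"
    if "continuous_on UNIV k" "r > 0" for k and r :: real
  proof -
    have "((\<lambda>R. integral {0..R} k) has_real_derivative k r) (at r within {0..r+1})"
      by (rule integral_has_real_derivative) (use that in \<open>auto intro: continuous_on_subset\<close>)
    then show ?thesis using that by (simp add: at_within_Icc_at)
  qed
  define G where "G k r = integral {0..r} (\<lambda>t. t^k * g t)" for k r
  define H where "H k r = integral {0..r} (\<lambda>t. t^k * h t)" for k r
  have int: "(\<lambda>t. t^k * f t) integrable_on {0..r}" if "continuous_on UNIV f" for f and k and r :: real
    by (intro integrable_continuous_interval continuous_intros continuous_on_subset[OF that]) auto
  have G': "(G k has_real_derivative r^k * g r) (at r)" if "r > 0" for k r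
    unfolding G_def by (rule I[OF _ that]) (intro continuous_intros g)
  have H': "(H k has_real_derivative r^k * h r) (at r)" if "r > 0" for k r
    unfolding H_def by (rule I[OF _ that]) (intro continuous_intros h)
  have expand2: "integral {0..r} (\<lambda>t. (r\<^sup>2 - t\<^sup>2)\<^sup>2 * g t) = r^4 * G 0 r - 2 * r\<^sup>2 * G 2 r + G 4 r" for r
  proof -
    have "((\<lambda>t. r^4 * (t^0 * g t) - 2 * r\<^sup>2 * (t\<^sup>2 * g t) + t^4 * g t) has_integral (r^4 * G 0 r - 2 * r\<^sup>2 * G 2 r + G 4 r)) {0..r}"
      unfolding G_def by (intro has_integral_add has_integral_diff has_integral_mult_right integrable_integral int g)
    moreover have "(\<lambda>t. r^4 * (t^0 * g t) - 2 * r\<^sup>2 * (t\<^sup>2 * g t) + t^4 * g t) = (\<lambda>t. (r\<^sup>2 - t\<^sup>2)\<^sup>2 * g t)"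
      by (intro ext) (simp add: power2_eq_square power4_eq_xxxx algebra_simps)
    ultimately show ?thesis by (simp add: integral_unique)
  qed
  have expand1: "integral {0..r} (\<lambda>t. (r\<^sup>2 - t\<^sup>2) * h t) = r\<^sup>2 * H 0 r - H 2 r" for r
  proof -
    have "((\<lambda>t. r\<^sup>2 * (t^0 * h t) - t\<^sup>2 * h t) has_integral (r\<^sup>2 * H 0 r - H 2 r)) {0..r}"
      unfolding H_def by (intro has_integral_diff has_integral_mult_right integrable_integral int h)
    then show ?thesis by (simp add: integral_unique left_diff_distrib)
  qed
  \<comment> \<open>Each differentiation in the radius lowers the power of \<open>r\<^sup>2 - t\<^sup>2\<close> by one; no boundary term appears.\<close>
  have D1: "r\<^sup>2 * G 0 r - G 2 r = 2 * H 0 r" if r: "r > 0" for r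
  proof -
    have "((\<lambda>r. r^4 * G 0 r - 2 * r\<^sup>2 * G 2 r + G 4 r) has_real_derivative 4 * r * (r\<^sup>2 * G 0 r - G 2 r)) (at r)"
      by (rule derivative_eq_intros G'[OF r] refl)+
         (simp add: power2_eq_square power3_eq_cube power4_eq_xxxx algebra_simps)
    moreover have "((\<lambda>r. r^4 * G 0 r - 2 * r\<^sup>2 * G 2 r + G 4 r) has_real_derivative 4 * (2 * r * H 0 r)) (at r)"
    proof (rule has_field_derivative_transform_within_open[where S="{0<..}"])
      show "((\<lambda>r. 4 * (r\<^sup>2 * H 0 r - H 2 r)) has_real_derivative 4 * (2 * r * H 0 r)) (at r)"
        by (rule derivative_eq_intros H'[OF r] refl)+ (simp add: algebra_simps)
    qed (use eq r in \<open>auto simp: expand1 expand2\<close>)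
    ultimately have "4 * r * (r\<^sup>2 * G 0 r - G 2 r) = 4 * (2 * r * H 0 r)" by (rule DERIV_unique)
    then show ?thesis using r by simp
  qed
  have "((\<lambda>r. r\<^sup>2 * G 0 r - G 2 r) has_real_derivative 2 * R * G 0 R) (at R)"
    by (rule derivative_eq_intros G'[OF R] refl)+ (simp add: algebra_simps)
  moreover have "((\<lambda>r. r\<^sup>2 * G 0 r - G 2 r) has_real_derivative 2 * h R) (at R)"
  proof (rule has_field_derivative_transform_within_open[where S="{0<..}"])
    show "((\<lambda>r. 2 * H 0 r) has_real_derivative 2 * h R) (at R)"
      by (rule derivative_eq_intros H'[OF R] refl)+ simp
  qed (use R D1 in auto)
  ultimately have "2 * R * G 0 R = 2 * h R" by (rule DERIV_unique)
  then show ?thesis by (simp add: G_def)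
qed

lemma cutoff_has_derivative:
  fixes x :: "'a::euclidean_space"
  shows "((\<lambda>x. (max 0 (R\<^sup>2 - x \<bullet> x))\<^sup>2) has_derivative (\<lambda>v. - 4 * max 0 (R\<^sup>2 - x \<bullet> x) * (x \<bullet> v))) (at x)"
proof -
  have sq: "((\<lambda>t::real. (max 0 t)\<^sup>2) has_real_derivative 2 * max 0 t) (at t)" for t
  proof -
    consider "t > 0" | "t < 0" | "t = 0" by linarith
    then show ?thesis
    proof cases
      case 1
      show ?thesis
        by (rule has_field_derivative_transform_within_open[where S="{0<..}" and f="\<lambda>t. t\<^sup>2"])
           (use 1 in \<open>auto intro!: derivative_eq_intros\<close>)
    next
      case 2
      show ?thesis
        by (rule has_field_derivative_transform_within_open[where S="{..<0}" and f="\<lambda>t. 0"])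
           (use 2 in auto)
    next
      case 3
      have "((\<lambda>h::real. (max 0 h)\<^sup>2 / h) \<longlongrightarrow> 0) (at 0)"
      proof (rule tendsto_rabs_zero_cancel, rule tendsto_sandwich)
        show "eventually (\<lambda>h::real. 0 \<le> \<bar>(max 0 h)\<^sup>2 / h\<bar>) (at 0)" by simp
        show "eventually (\<lambda>h::real. \<bar>(max 0 h)\<^sup>2 / h\<bar> \<le> \<bar>h\<bar>) (at 0)"
          by (intro always_eventually) (auto simp: max_def power2_eq_square)
        show "((\<lambda>h::real. \<bar>h\<bar>) \<longlongrightarrow> 0) (at 0)" by (intro tendsto_rabs_zero tendsto_ident_at)
      qed simp
      then show ?thesis using 3 by (simp add: DERIV_def)
    qed
  qed
  have "((\<lambda>x. R\<^sup>2 - x \<bullet> x) has_derivative (\<lambda>v. - 2 * (x \<bullet> v))) (at x)"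
    by (auto intro!: derivative_eq_intros simp: inner_commute)
  from has_derivative_compose[OF this sq[unfolded has_field_derivative_def]]
  show ?thesis by (simp add: mult_ac)
qed

text \<open>The field \<open>(max 0 (R\<^sup>2 - |x|\<^sup>2))\<^sup>2 W\<close> is continuously differentiable with compact support, so its divergence
  integrates to \<open>0\<close>; the product rule gives the two terms.\<close>

lemma divergence_theorem_cutoff:
  fixes W :: "'a::euclidean_space \<Rightarrow> 'a"
  assumes W: "\<And>b. b \<in> Basis \<Longrightarrow> C_on 1 UNIV (\<lambda>x. W x \<bullet> b)"
  defines "u \<equiv> \<lambda>R x. max 0 (R\<^sup>2 - x \<bullet> x)"
  shows "(LINT x|lborel. (u R x)\<^sup>2 * (\<Sum>b\<in>Basis. frechet_derivative (\<lambda>x. W x \<bullet> b) (at x) b) - 4 * u R x * (x \<bullet> W x)) = 0"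
proof -
  define F where "F b x = (u R x)\<^sup>2 * (W x \<bullet> b)" for b x
  define F' where "F' b x v = (u R x)\<^sup>2 * frechet_derivative (\<lambda>x. W x \<bullet> b) (at x) v + (- 4 * u R x * (x \<bullet> v)) * (W x \<bullet> b)" for b x v
  have F': "C_on 1 UNIV (F b)" "frechet_derivative (F b) (at x) = F' b x" if b: "b \<in> Basis" for b x
  proof -
    have d: "(F b has_derivative F' b x) (at x)" for x
      unfolding F_def F'_def u_def
      by (rule has_derivative_mult[OF cutoff_has_derivative C1_has_derivative[OF W[OF b]]])
    have c: "continuous_on UNIV (\<lambda>x. F' b x v)" for v
      unfolding F'_def u_def
      by (intro continuous_intros C1_derivative_continuous[OF W[OF b]] C1_continuous[OF W[OF b]])
    show "C_on 1 UNIV (F b)" "frechet_derivative (F b) (at x) = F' b x"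
      using C1I[OF d c] by auto
  qed
  have supp: "F b x = 0" if "norm x > \<bar>R\<bar>" for b x
  proof -
    have "\<bar>R\<bar>\<^sup>2 < (norm x)\<^sup>2" using that by (intro power_strict_mono) auto
    then show ?thesis by (simp add: F_def u_def dot_square_norm)
  qed
  have "(\<Sum>b\<in>Basis. F' b x b) = (u R x)\<^sup>2 * (\<Sum>b\<in>Basis. frechet_derivative (\<lambda>x. W x \<bullet> b) (at x) b) - 4 * u R x * (x \<bullet> W x)" for x
  proof -
    have "x \<bullet> W x = (\<Sum>b\<in>Basis. (x \<bullet> b) * (W x \<bullet> b))" by (rule euclidean_inner)
    then show ?thesis
      by (simp add: F'_def sum.distrib sum_subtractf sum_distrib_left mult.assoc)
  qed
  moreover have "(LINT x|lborel. (\<Sum>b\<in>Basis. F' b x b)) = (\<Sum>b\<in>Basis. (LINT x|lborel. F' b x b))"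
    using integral_directional_derivative_eq_0(1)[OF F'(1) supp] F'(2)
    by (intro Bochner_Integration.integral_sum) simp
  moreover have "(LINT x|lborel. F' b x b) = 0" if "b \<in> Basis" for b
    using integral_directional_derivative_eq_0(2)[OF F'(1)[OF that] supp] F'(2)[OF that] by simp
  ultimately show ?thesis by simp
qed

text \<open>The divergence theorem for \<open>W\<close> on the ball of radius \<open>R\<close>, in polar coordinates: the left side is
  \<open>R\<close> times the flux of \<open>W\<close> through the sphere, the right side \<open>R\<close> times the integral of \<open>div W\<close>.\<close>

lemma radial_flux_identity:
  fixes e beta :: "'a::euclidean_space \<Rightarrow> real" and W :: "'a \<Rightarrow> 'a"
  assumes e: "C_on 1 UNIV e" "\<And>x. e x \<ge> 0" and beta: "C_on 1 UNIV beta" "\<And>x. beta x \<ge> 0"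
    and W: "\<And>b. b \<in> Basis \<Longrightarrow> C_on 1 UNIV (\<lambda>x. W x \<bullet> b)"
    and div: "\<And>x. (\<Sum>b\<in>Basis. frechet_derivative (\<lambda>x. W x \<bullet> b) (at x) b) = (real DIM('a) - 2) * e x - beta x / 2"
    and flux: "\<And>x. x \<bullet> W x = (norm x)\<^sup>2 * e x - beta x"
    and R: "R > 0"
  defines "p \<equiv> sphere_integral e" and "q \<equiv> sphere_integral beta"
  shows "R^(DIM('a)-1) * (R\<^sup>2 * p R - q R) =
    R * integral {0..R} (\<lambda>r. r^(DIM('a)-1) * ((real DIM('a) - 2) * p r - q r / 2))"
proof -
  let ?m = "DIM('a)"
  define g where "g r = r^(?m-1) * ((real ?m - 2) * p r - q r / 2)" for r
  define h where "h r = r^(?m-1) * (r\<^sup>2 * p r - q r)" for r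
  have pc: "continuous_on UNIV p" and qc: "continuous_on UNIV q"
    unfolding p_def q_def by (intro continuous_sphere_integral e beta)+
  have "h R = R * integral {0..R} g"
  proof (rule flux_from_cutoff_moments[OF _ _ _ R])
    show "continuous_on UNIV g" "continuous_on UNIV h"
      unfolding g_def h_def by (intro continuous_intros pc qc; simp)+
    fix R :: real assume R: "R > 0"
    have le: "0 \<le> R\<^sup>2 - r\<^sup>2" if "0 \<le> r" "r \<le> R" for r
      using power_mono[OF that(2) that(1), of 2] by simp
    define B where "B = (\<lambda>f w. integral {0..R} (\<lambda>r. w r * (r^(?m-1) * f r)))"
    note pol = integral_polar[OF _ _ _ _ less_imp_le[OF R], of _ _ "cball (0::'a) R", OF _ _ _ _ ball_subset_cball order_refl]
    have E1: "has_bochner_integral lborel (\<lambda>x. indicator (cball 0 R) x * ((R\<^sup>2 - (norm x)\<^sup>2)\<^sup>2 * e x)) (B p (\<lambda>r. (R\<^sup>2 - r\<^sup>2)\<^sup>2))"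
      unfolding B_def p_def by (rule pol[OF e]) (auto intro!: continuous_intros)
    have E2: "has_bochner_integral lborel (\<lambda>x. indicator (cball 0 R) x * ((R\<^sup>2 - (norm x)\<^sup>2)\<^sup>2 * beta x)) (B q (\<lambda>r. (R\<^sup>2 - r\<^sup>2)\<^sup>2))"
      unfolding B_def q_def by (rule pol[OF beta]) (auto intro!: continuous_intros)
    have E3: "has_bochner_integral lborel (\<lambda>x. indicator (cball 0 R) x * (((R\<^sup>2 - (norm x)\<^sup>2) * (norm x)\<^sup>2) * e x)) (B p (\<lambda>r. (R\<^sup>2 - r\<^sup>2) * r\<^sup>2))"
      unfolding B_def p_def by (rule pol[OF e]) (use le in \<open>auto intro!: continuous_intros\<close>)
    have E4: "has_bochner_integral lborel (\<lambda>x. indicator (cball 0 R) x * ((R\<^sup>2 - (norm x)\<^sup>2) * beta x)) (B q (\<lambda>r. (R\<^sup>2 - r\<^sup>2)))"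
      unfolding B_def q_def by (rule pol[OF beta]) (use le in \<open>auto intro!: continuous_intros\<close>)
    have "has_bochner_integral lborel (\<lambda>x. ((real ?m - 2) * (indicator (cball 0 R) x * ((R\<^sup>2 - (norm x)\<^sup>2)\<^sup>2 * e x))
          - 1/2 * (indicator (cball 0 R) x * ((R\<^sup>2 - (norm x)\<^sup>2)\<^sup>2 * beta x)))
          - (4 * (indicator (cball 0 R) x * (((R\<^sup>2 - (norm x)\<^sup>2) * (norm x)\<^sup>2) * e x))
          - 4 * (indicator (cball 0 R) x * ((R\<^sup>2 - (norm x)\<^sup>2) * beta x))))
        (((real ?m - 2) * B p (\<lambda>r. (R\<^sup>2 - r\<^sup>2)\<^sup>2) - 1/2 * B q (\<lambda>r. (R\<^sup>2 - r\<^sup>2)\<^sup>2))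
          - (4 * B p (\<lambda>r. (R\<^sup>2 - r\<^sup>2) * r\<^sup>2) - 4 * B q (\<lambda>r. (R\<^sup>2 - r\<^sup>2))))"
      by (intro has_bochner_integral_diff has_bochner_integral_mult_right E1 E2 E3 E4)
    moreover have "((real ?m - 2) * (indicator (cball 0 R) x * ((R\<^sup>2 - (norm x)\<^sup>2)\<^sup>2 * e x))
          - 1/2 * (indicator (cball 0 R) x * ((R\<^sup>2 - (norm x)\<^sup>2)\<^sup>2 * beta x)))
          - (4 * (indicator (cball 0 R) x * (((R\<^sup>2 - (norm x)\<^sup>2) * (norm x)\<^sup>2) * e x))
          - 4 * (indicator (cball 0 R) x * ((R\<^sup>2 - (norm x)\<^sup>2) * beta x)))
        = (max 0 (R\<^sup>2 - x \<bullet> x))\<^sup>2 * (\<Sum>b\<in>Basis. frechet_derivative (\<lambda>x. W x \<bullet> b) (at x) b) - 4 * max 0 (R\<^sup>2 - x \<bullet> x) * (x \<bullet> W x)" for x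
    proof (cases "norm x \<le> R")
      case True
      then have u: "max 0 (R\<^sup>2 - x \<bullet> x) = R\<^sup>2 - (norm x)\<^sup>2"
        using le[of "norm x"] by (simp add: dot_square_norm)
      show ?thesis unfolding u div flux using True by (simp add: algebra_simps)
    next
      case False
      then have "R\<^sup>2 < (norm x)\<^sup>2" using R by (intro power_strict_mono) auto
      then have "max 0 (R\<^sup>2 - x \<bullet> x) = 0" by (simp add: dot_square_norm)
      then show ?thesis using False by simp
    qed
    ultimately have *: "(real ?m - 2) * B p (\<lambda>r. (R\<^sup>2 - r\<^sup>2)\<^sup>2) - 1/2 * B q (\<lambda>r. (R\<^sup>2 - r\<^sup>2)\<^sup>2)
        = 4 * B p (\<lambda>r. (R\<^sup>2 - r\<^sup>2) * r\<^sup>2) - 4 * B q (\<lambda>r. (R\<^sup>2 - r\<^sup>2))"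
      using divergence_theorem_cutoff[OF W, of R] by (simp add: has_bochner_integral_iff)
    have hi: "((\<lambda>r. w r * (r^(?m-1) * f r)) has_integral B f w) {0..R}" if "continuous_on UNIV w" "continuous_on UNIV f" for w f
      unfolding B_def
      by (intro integrable_integral integrable_continuous_interval continuous_intros continuous_on_subset[OF that(1)] continuous_on_subset[OF that(2)]) auto
    have "((\<lambda>r. (real ?m - 2) * ((R\<^sup>2 - r\<^sup>2)\<^sup>2 * (r^(?m-1) * p r)) - 1/2 * ((R\<^sup>2 - r\<^sup>2)\<^sup>2 * (r^(?m-1) * q r))) has_integral
        ((real ?m - 2) * B p (\<lambda>r. (R\<^sup>2 - r\<^sup>2)\<^sup>2) - 1/2 * B q (\<lambda>r. (R\<^sup>2 - r\<^sup>2)\<^sup>2))) {0..R}"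
      by (intro has_integral_diff has_integral_mult_right hi pc qc continuous_intros)
    then have 1: "integral {0..R} (\<lambda>r. (R\<^sup>2 - r\<^sup>2)\<^sup>2 * g r) = (real ?m - 2) * B p (\<lambda>r. (R\<^sup>2 - r\<^sup>2)\<^sup>2) - 1/2 * B q (\<lambda>r. (R\<^sup>2 - r\<^sup>2)\<^sup>2)"
      by (intro integral_unique) (simp add: g_def algebra_simps)
    have "((\<lambda>r. ((R\<^sup>2 - r\<^sup>2) * r\<^sup>2) * (r^(?m-1) * p r) - (R\<^sup>2 - r\<^sup>2) * (r^(?m-1) * q r)) has_integral
        (B p (\<lambda>r. (R\<^sup>2 - r\<^sup>2) * r\<^sup>2) - B q (\<lambda>r. (R\<^sup>2 - r\<^sup>2)))) {0..R}"
      by (intro has_integral_diff hi pc qc continuous_intros)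
    then have 2: "integral {0..R} (\<lambda>r. (R\<^sup>2 - r\<^sup>2) * h r) = B p (\<lambda>r. (R\<^sup>2 - r\<^sup>2) * r\<^sup>2) - B q (\<lambda>r. (R\<^sup>2 - r\<^sup>2))"
      by (intro integral_unique) (simp add: h_def algebra_simps)
    show "integral {0..R} (\<lambda>r. (R\<^sup>2 - r\<^sup>2)\<^sup>2 * g r) = 4 * integral {0..R} (\<lambda>r. (R\<^sup>2 - r\<^sup>2) * h r)"
      unfolding 1 2 * by simp
  qed
  then show ?thesis by (simp add: g_def[abs_def] h_def)
qed

section \<open>The equivalence for a field with prescribed divergence\<close>

text \<open>The pointwise bound on spheres is obtained from balls: the integral of \<open>c |x|\<^sup>2 g - f \<ge> 0\<close> over the ball of
  radius \<open>R\<close> increases with \<open>R\<close>, and its derivative is the difference of the two spherical integrals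
  up to a positive factor.\<close>

lemma sphere_integral_radial_mono:
  fixes f g :: "'a::euclidean_space \<Rightarrow> real"
  assumes f: "C_on 1 UNIV f" "\<And>x. f x \<ge> 0" and g: "C_on 1 UNIV g" "\<And>x. g x \<ge> 0"
    and c: "c \<ge> 0" and le: "\<And>x. f x \<le> c * (norm x)\<^sup>2 * g x" and r: "r \<ge> 0"
  shows "sphere_integral f r \<le> c * r\<^sup>2 * sphere_integral g r"
proof -
  let ?m = "DIM('a)"
  define p q where "p = sphere_integral g" and "q = sphere_integral f"
  have pc: "continuous_on UNIV p" and qc: "continuous_on UNIV q"
    unfolding p_def q_def by (intro continuous_sphere_integral f g)+
  define k where "k r = (c * r\<^sup>2) * (r^(?m-1) * p r) - 1 * (r^(?m-1) * q r)" for r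
  have kc: "continuous_on UNIV k" unfolding k_def by (intro continuous_intros pc qc)
  have kball: "has_bochner_integral lborel (\<lambda>x. indicator (cball 0 R) x * ((c * (norm x)\<^sup>2) * g x) - indicator (cball 0 R) x * (1 * f x)) (integral {0..R} k)"
    if R: "R \<ge> 0" for R
  proof -
    note pol = integral_polar[OF _ _ _ _ R, of _ _ "cball (0::'a) R", OF _ _ _ _ ball_subset_cball order_refl]
    have hi: "(\<lambda>r. w r * (r^(?m-1) * f r)) integrable_on {0..R}" if "continuous_on UNIV w" "continuous_on UNIV f" for w f :: "real \<Rightarrow> real"
      by (intro integrable_continuous_interval continuous_intros continuous_on_subset[OF that(1)] continuous_on_subset[OF that(2)]) auto
    have "integral {0..R} k = integral {0..R} (\<lambda>r. (c * r\<^sup>2) * (r^(?m-1) * p r)) - integral {0..R} (\<lambda>r. 1 * (r^(?m-1) * q r))"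
      unfolding k_def by (intro Henstock_Kurzweil_Integration.integral_diff hi pc qc continuous_intros)
    then show ?thesis unfolding p_def q_def
      by (simp only:) (intro has_bochner_integral_diff pol[OF g] pol[OF f], use c in \<open>auto intro!: continuous_intros\<close>)
  qed
  have "k r \<ge> 0" if r: "r > 0" for r
  proof (rule integrand_nonneg_if_integral_mono[OF kc _ r])
    fix r s :: real assume rs: "0 < r" "r \<le> s"
    let ?A = "\<lambda>R x. indicator (cball 0 R) x * ((c * (norm x)\<^sup>2) * g x) - indicator (cball 0 R) x * (1 * f x)"
    have "(LINT x|lborel. ?A r x) \<le> (LINT x|lborel. ?A s x)"
    proof (rule integral_mono)
      fix x :: 'a
      show "?A r x \<le> ?A s x"
        using rs le[of x] by (auto simp: indicator_def)
    qed (use kball[of r] kball[of s] rs in \<open>simp_all add: has_bochner_integral_iff\<close>)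
    then show "integral {0..r} k \<le> integral {0..s} k"
      using kball[of r] kball[of s] rs by (simp add: has_bochner_integral_iff)
  qed
  then have kn: "r > 0 \<Longrightarrow> k r \<ge> 0" for r .
  have "c * r\<^sup>2 * p r - q r \<ge> 0"
  proof (rule nonneg_on_halfline_if_nonneg_pos[OF _ _ r, where g="\<lambda>r. c * r\<^sup>2 * p r - q r"])
    show "continuous_on UNIV (\<lambda>r. c * r\<^sup>2 * p r - q r)" by (intro continuous_intros pc qc)
    fix r :: real assume r: "r > 0"
    have "k r = r^(?m-1) * (c * r\<^sup>2 * p r - q r)" by (simp add: k_def algebra_simps)
    then show "c * r\<^sup>2 * p r - q r \<ge> 0"
      using kn[OF r] r by (metis linorder_not_le mult_pos_neg zero_less_power)
  qed
  then show ?thesis by (simp add: p_def q_def)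
qed

text \<open>The analytic content of the theorem, free of geometry: polar coordinates translate the three conditions into
  those of \<open>radial_energy_equivalence\<close>. In (2) the weight \<open>|x|\<^sup>2\<^sup>-\<^sup>m\<close> and the Jacobian \<open>r\<^sup>m\<^sup>-\<^sup>1\<close> combine to the
  factor \<open>r\<close>, so the singularity at the origin disappears.\<close>

lemma energy_equivalence:
  fixes e beta :: "'a::euclidean_space \<Rightarrow> real" and W :: "'a \<Rightarrow> 'a"
  assumes m: "DIM('a) > 2"
    and e: "C_on 1 UNIV e" "\<And>x. e x \<ge> 0" and beta: "C_on 1 UNIV beta" "\<And>x. beta x \<ge> 0"
    and le: "\<And>x. beta x \<le> 2 * (norm x)\<^sup>2 * e x"
    and W: "\<And>b. b \<in> Basis \<Longrightarrow> C_on 1 UNIV (\<lambda>x. W x \<bullet> b)"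
    and div: "\<And>x. (\<Sum>b\<in>Basis. frechet_derivative (\<lambda>x. W x \<bullet> b) (at x) b) = (real DIM('a) - 2) * e x - beta x / 2"
    and flux: "\<And>x. x \<bullet> W x = (norm x)\<^sup>2 * e x - beta x"
  defines "C1 \<equiv> ((\<lambda>R. R^DIM('a) * exp (- R\<^sup>2/4) * (LINT x:ball 0 R|lborel. e x * exp (- (norm x)\<^sup>2/4))) \<longlongrightarrow> 0) at_top"
    and "C2 \<equiv> (\<integral>\<^sup>+ x. ennreal (beta x * norm x powi (2 - int DIM('a))) \<partial>lborel) < \<infinity>"
    and "C3 \<equiv> (\<integral>\<^sup>+ x. ennreal (e x * exp (- (norm x)\<^sup>2/4)) \<partial>lborel) < \<infinity>"
  shows "(C1 \<longleftrightarrow> C2) \<and> (C2 \<longleftrightarrow> C3)"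
proof -
  let ?m = "DIM('a)"
  define p q where "p = sphere_integral e" and "q = sphere_integral beta"
  have pc: "continuous_on UNIV p" and qc: "continuous_on UNIV q"
    unfolding p_def q_def by (intro continuous_sphere_integral e beta)+
  have pn: "p r \<ge> 0" and qn: "q r \<ge> 0" if "r \<ge> 0" for r
    unfolding p_def q_def using sphere_integral_nonneg[OF e that] sphere_integral_nonneg[OF beta that] .
  have "q r \<le> 2 * r\<^sup>2 * p r" if "r \<ge> 0" for r
    unfolding p_def q_def by (rule sphere_integral_radial_mono[OF beta e _ le that]) simp
  note radial = radial_energy_equivalence[OF m pc qc pn qn this radial_flux_identity[OF e beta W div flux, folded p_def q_def]]
  have C1: "C1 \<longleftrightarrow> ((\<lambda>R. R^?m * exp (- R\<^sup>2/4) * integral {0..R} (\<lambda>r. r^(?m-1) * p r * exp (- r\<^sup>2/4))) \<longlongrightarrow> 0) at_top"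
    unfolding C1_def
  proof (rule tendsto_cong, rule eventually_at_top_linorderI[of 0])
    fix R :: real assume R: "0 \<le> R"
    have "has_bochner_integral lborel (\<lambda>x. indicator (ball 0 R) x * (exp (- (norm x)\<^sup>2/4) * e x)) (integral {0..R} (\<lambda>r. exp (- r\<^sup>2/4) * (r^(?m-1) * p r)))"
      unfolding p_def by (rule integral_polar[OF e _ _ R]) (auto intro!: continuous_intros)
    then have "(LINT x:ball 0 R|lborel. e x * exp (- (norm x)\<^sup>2/4)) = integral {0..R} (\<lambda>r. exp (- r\<^sup>2/4) * (r^(?m-1) * p r))"
      by (simp add: has_bochner_integral_iff set_lebesgue_integral_def mult.commute)
    then show "R^?m * exp (- R\<^sup>2/4) * (LINT x:ball 0 R|lborel. e x * exp (- (norm x)\<^sup>2/4)) =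
       R^?m * exp (- R\<^sup>2/4) * integral {0..R} (\<lambda>r. r^(?m-1) * p r * exp (- r\<^sup>2/4))"
      by (simp add: mult_ac)
  qed
  have "(\<integral>\<^sup>+ x. ennreal (beta x * norm x powi (2 - int ?m)) \<partial>lborel) = (\<integral>\<^sup>+ x. ennreal (norm x powi (2 - int ?m)) * ennreal (beta x) \<partial>lborel)"
    using beta(2) by (intro nn_integral_cong) (simp add: mult.commute flip: ennreal_mult)
  also have "\<dots> = (\<integral>\<^sup>+ r. ennreal (r powi (2 - int ?m)) * (ennreal (r^(?m-1) * q r) * indicator {0..} r) \<partial>lborel)"
    unfolding q_def by (rule nn_integral_polar[OF beta]) (simp add: power_int_def)
  also have "\<dots> = (\<integral>\<^sup>+ r. ennreal (r * q r) * indicator {0..} r \<partial>lborel)"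
  proof (rule nn_integral_cong)
    fix r :: real
    show "ennreal (r powi (2 - int ?m)) * (ennreal (r^(?m-1) * q r) * indicator {0..} r) = ennreal (r * q r) * indicator {0..} r"
    proof (cases "r > 0")
      case True
      define n where "n = ?m - 2"
      have n: "?m = n + 2" using m by (simp add: n_def)
      have "r powi (2 - int ?m) * r^(?m-1) = r"
        using True by (simp add: n power_int_minus field_simps)
      then have "r powi (2 - int ?m) * (r^(?m-1) * q r) = r * q r" by (simp flip: mult.assoc)
      then show ?thesis using True qn[of r] by (simp flip: ennreal_mult)
    next
      case False
      then show ?thesis using m by (cases "r = 0") auto
    qed
  qed
  finally have C2: "C2 \<longleftrightarrow> (\<integral>\<^sup>+ r. ennreal (r * q r) * indicator {0..} r \<partial>lborel) < \<infinity>"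
    by (simp add: C2_def)
  have "(\<integral>\<^sup>+ x. ennreal (e x * exp (- (norm x)\<^sup>2/4)) \<partial>lborel) = (\<integral>\<^sup>+ x. ennreal (exp (- (norm x)\<^sup>2/4)) * ennreal (e x) \<partial>lborel)"
    using e(2) by (intro nn_integral_cong) (simp add: mult.commute flip: ennreal_mult)
  also have "\<dots> = (\<integral>\<^sup>+ r. ennreal (exp (- r\<^sup>2/4)) * (ennreal (r^(?m-1) * p r) * indicator {0..} r) \<partial>lborel)"
    unfolding p_def by (rule nn_integral_polar[OF e]) simp
  also have "\<dots> = (\<integral>\<^sup>+ r. ennreal (r^(?m-1) * p r * exp (- r\<^sup>2/4)) * indicator {0..} r \<partial>lborel)"
    using pn by (intro nn_integral_cong) (auto simp: mult.commute indicator_def simp flip: ennreal_mult)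
  finally have C3: "C3 \<longleftrightarrow> (\<integral>\<^sup>+ r. ennreal (r^(?m-1) * p r * exp (- r\<^sup>2/4)) * indicator {0..} r \<partial>lborel) < \<infinity>"
    by (simp add: C3_def)
  show ?thesis unfolding C1 C2 C3 by (rule radial)
qed

section \<open>Smooth functions and symmetry of second derivatives\<close>

text \<open>The derivative operator is total, so locality has to be argued through the relation \<open>has_derivative\<close>,
  which is insensitive to changes away from the point.\<close>

lemma frechet_derivative_cong_open:
  assumes "open S" "x \<in> S" "\<And>z. z \<in> S \<Longrightarrow> f z = g z"
  shows "frechet_derivative f (at x) = frechet_derivative g (at x)"
proof -
  have "(f has_derivative D) (at x) \<longleftrightarrow> (g has_derivative D) (at x)" for D
    using has_derivative_transform_within_open[of f D x UNIV S g] has_derivative_transform_within_open[of g D x UNIV S f] assms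
    by auto
  then show ?thesis by (simp add: frechet_derivative_def)
qed

lemma differentiable_cong_open:
  assumes "open S" "x \<in> S" "\<And>z. z \<in> S \<Longrightarrow> f z = g z" "f differentiable (at x)"
  shows "g differentiable (at x)"
  using has_derivative_transform_within_open[of f _ x UNIV S g] assms
  unfolding differentiable_def by blast

lemma C_on_cong:
  assumes "open S"
  shows "(\<And>z. z \<in> S \<Longrightarrow> f z = g z) \<Longrightarrow> C_on k S f \<Longrightarrow> C_on k S g"
proof (induction k arbitrary: f g)
  case 0
  then show ?case using continuous_on_cong[of S S f g] by simp
next
  case (Suc k)
  have "C_on k S (\<lambda>x. frechet_derivative g (at x) v)" for v
  proof (rule Suc.IH)
    show "C_on k S (\<lambda>x. frechet_derivative f (at x) v)" using Suc.prems by simp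
    show "frechet_derivative f (at z) v = frechet_derivative g (at z) v" if "z \<in> S" for z
      using frechet_derivative_cong_open[OF assms that, of f g] Suc.prems(1) by simp
  qed
  moreover have "g differentiable (at x)" if "x \<in> S" for x
    using differentiable_cong_open[OF assms that, of f g] Suc.prems that by simp
  ultimately show ?case by simp
qed

lemma frechet_derivative_component:
  fixes f :: "'a::real_normed_vector \<Rightarrow> 'b::euclidean_space^'n::finite"
  assumes "f differentiable (at x)"
  shows "(\<lambda>z. f z $ k) differentiable (at x)"
    and "frechet_derivative (\<lambda>z. f z $ k) (at x) v = frechet_derivative f (at x) v $ k"
proof -
  have "(f has_derivative frechet_derivative f (at x)) (at x)"
    using assms by (simp flip: frechet_derivative_works)
  then have d: "((\<lambda>z. f z $ k) has_derivative (\<lambda>v. frechet_derivative f (at x) v $ k)) (at x)"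
    by (rule bounded_linear.has_derivative[OF bounded_linear_vec_nth])
  then show "(\<lambda>z. f z $ k) differentiable (at x)" by (auto simp: differentiable_def)
  show "frechet_derivative (\<lambda>z. f z $ k) (at x) v = frechet_derivative f (at x) v $ k"
    using frechet_derivative_at[OF d] by metis
qed

lemma C_on_component:
  fixes f :: "'a::real_normed_vector \<Rightarrow> 'b::euclidean_space^'n::finite"
  assumes "open S" shows "C_on m S f \<Longrightarrow> C_on m S (\<lambda>x. f x $ k)"
proof (induction m arbitrary: f)
  case 0
  then show ?case by (auto intro: continuous_intros)
next
  case (Suc m)
  have "C_on m S (\<lambda>x. frechet_derivative (\<lambda>z. f z $ k) (at x) v)" for v
  proof (rule C_on_cong[OF assms])
    show "C_on m S (\<lambda>x. frechet_derivative f (at x) v $ k)"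
      using Suc.prems by (intro Suc.IH) simp
    show "frechet_derivative f (at z) v $ k = frechet_derivative (\<lambda>z. f z $ k) (at z) v" if "z \<in> S" for z
      using frechet_derivative_component(2)[of f z k v] Suc.prems that by simp
  qed
  then show ?case using frechet_derivative_component(1)[of f _ k] Suc.prems by simp
qed

lemma smooth_on_component:
  fixes f :: "'a::real_normed_vector \<Rightarrow> 'b::euclidean_space^'n::finite"
  assumes "open S" "smooth_on S f" shows "smooth_on S (\<lambda>x. f x $ k)"
  using assms C_on_component unfolding smooth_on_def by blast

lemma smooth_on_frechet_derivative:
  "smooth_on S f \<Longrightarrow> smooth_on S (\<lambda>x. frechet_derivative f (at x) v)"
  unfolding smooth_on_def by (metis C_on.simps(2))

lemma smooth_on_has_derivative:
  "smooth_on S f \<Longrightarrow> x \<in> S \<Longrightarrow> (f has_derivative frechet_derivative f (at x)) (at x)"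
  using smooth_on_differentiable by (simp flip: frechet_derivative_works)

lemma smooth_on_continuous: "smooth_on S f \<Longrightarrow> continuous_on S f"
  unfolding smooth_on_def by (metis C_on.simps(1))

text \<open>Two applications of the mean value theorem express the second difference, which is symmetric in \<open>v\<close> and \<open>w\<close>,
  by a mixed derivative taken in one order at a nearby point.\<close>

lemma second_difference_mean_value:
  fixes f :: "'a::real_normed_vector \<Rightarrow> real"
  assumes f: "smooth_on S f" and S: "ball x r \<subseteq> S" and t: "t > 0" "t * (norm v + norm w) < r"
  shows "\<exists>z. norm (z - x) \<le> t * (norm v + norm w) \<and>
    f (x + t *\<^sub>R v + t *\<^sub>R w) - f (x + t *\<^sub>R v) - f (x + t *\<^sub>R w) + f x =
    t * (t * frechet_derivative (\<lambda>z. frechet_derivative f (at z) v) (at z) w)"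
proof -
  let ?g = "\<lambda>z. frechet_derivative f (at z) v"
  let ?pt = "\<lambda>a b. x + a *\<^sub>R v + b *\<^sub>R w"
  have bound: "norm (?pt a b - x) \<le> t * (norm v + norm w)" if "0 \<le> a" "a \<le> t" "0 \<le> b" "b \<le> t" for a b
  proof -
    have "norm (?pt a b - x) \<le> norm (a *\<^sub>R v) + norm (b *\<^sub>R w)"
      using norm_triangle_ineq[of "a *\<^sub>R v" "b *\<^sub>R w"] by (simp add: add.assoc)
    also have "\<dots> \<le> t * norm v + t * norm w"
      using that by (intro add_mono) (auto intro: mult_right_mono)
    finally show ?thesis by (simp add: algebra_simps)
  qed
  have inS: "?pt a b \<in> S" if "0 \<le> a" "a \<le> t" "0 \<le> b" "b \<le> t" for a b
  proof -
    have "dist (?pt a b) x < r"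
      unfolding dist_norm by (rule le_less_trans[OF bound[OF that] t(2)])
    then show ?thesis using S by (auto simp: dist_commute)
  qed
  have line: "((\<lambda>s. h (p + s *\<^sub>R d)) has_real_derivative frechet_derivative h (at (p + s *\<^sub>R d)) d) (at s)"
    if "smooth_on S h" "p + s *\<^sub>R d \<in> S" for h :: "'a \<Rightarrow> real" and p d s
  proof -
    note D = smooth_on_has_derivative[OF that]
    have aff: "((\<lambda>s. p + s *\<^sub>R d) has_derivative (\<lambda>k. k *\<^sub>R d)) (at s)"
      by (auto intro!: derivative_eq_intros)
    have "((\<lambda>s. h (p + s *\<^sub>R d)) has_derivative (\<lambda>k. frechet_derivative h (at (p + s *\<^sub>R d)) (k *\<^sub>R d))) (at s)"
      by (rule has_derivative_compose[OF aff D])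
    moreover have "frechet_derivative h (at (p + s *\<^sub>R d)) (k *\<^sub>R d) = frechet_derivative h (at (p + s *\<^sub>R d)) d * k" for k
      using has_derivative_linear[OF D] by (simp add: linear_scale)
    ultimately show ?thesis by (simp add: has_field_derivative_def)
  qed
  define phi where "phi s = f (?pt s t) - f (?pt s 0)" for s
  have phi': "(phi has_real_derivative ?g (?pt s t) - ?g (?pt s 0)) (at s)" if "0 \<le> s" "s \<le> t" for s
  proof -
    have 1: "((\<lambda>s. f ((x + t *\<^sub>R w) + s *\<^sub>R v)) has_real_derivative ?g ((x + t *\<^sub>R w) + s *\<^sub>R v)) (at s)"
      by (rule line[OF f]) (use inS[of s t] that t in \<open>simp add: ac_simps\<close>)
    have 2: "((\<lambda>s. f (x + s *\<^sub>R v)) has_real_derivative ?g (x + s *\<^sub>R v)) (at s)"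
      by (rule line[OF f]) (use inS[of s 0] that t in simp)
    show ?thesis using DERIV_diff[OF 1 2] by (simp add: phi_def[abs_def] ac_simps)
  qed
  obtain a where a: "0 < a" "a < t" "phi t - phi 0 = (t - 0) * (?g (?pt a t) - ?g (?pt a 0))"
    using MVT2[OF t(1), of phi "\<lambda>s. ?g (?pt s t) - ?g (?pt s 0)"] phi' by blast
  have g': "((\<lambda>b. ?g (?pt a b)) has_real_derivative frechet_derivative ?g (at (?pt a b)) w) (at b)"
    if "0 \<le> b" "b \<le> t" for b
    by (rule line[OF smooth_on_frechet_derivative[OF f]]) (use inS[of a b] that a(1,2) in auto)
  obtain b where b: "0 < b" "b < t" "?g (?pt a t) - ?g (?pt a 0) = (t - 0) * frechet_derivative ?g (at (?pt a b)) w"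
    using MVT2[OF t(1), of "\<lambda>b. ?g (?pt a b)" "\<lambda>b. frechet_derivative ?g (at (?pt a b)) w"]
      g' by blast
  show ?thesis
    using a(3) b(3) bound[of a b] a(1,2) b(1,2)
    by (intro exI[of _ "?pt a b"]) (simp add: phi_def)
qed

text \<open>Schwarz's theorem: both mixed derivatives, at points tending to \<open>x\<close>, equal the same second difference quotient.\<close>

lemma second_derivative_symmetric:
  fixes f :: "'a::real_normed_vector \<Rightarrow> real"
  assumes S: "open S" "x \<in> S" and f: "smooth_on S f"
  shows "frechet_derivative (\<lambda>z. frechet_derivative f (at z) v) (at x) w =
    frechet_derivative (\<lambda>z. frechet_derivative f (at z) w) (at x) v"
proof -
  define H where "H v w z = frechet_derivative (\<lambda>z. frechet_derivative f (at z) v) (at z) w" for v w z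
  have Hc: "isCont (H v w) x" for v w
    using smooth_on_continuous[OF smooth_on_frechet_derivative[OF smooth_on_frechet_derivative[OF f]]] S
    by (auto simp: H_def[abs_def] continuous_on_eq_continuous_at)
  have "\<bar>H v w x - H w v x\<bar> \<le> e" if e: "e > 0" for e
  proof -
    obtain r where r: "r > 0" "ball x r \<subseteq> S" using S openE by blast
    obtain d1 where d1: "d1 > 0" "\<And>z. dist z x < d1 \<Longrightarrow> dist (H v w z) (H v w x) < e/2"
      using Hc[of v w] half_gt_zero[OF e] unfolding continuous_at_eps_delta by blast
    obtain d2 where d2: "d2 > 0" "\<And>z. dist z x < d2 \<Longrightarrow> dist (H w v z) (H w v x) < e/2"
      using Hc[of w v] half_gt_zero[OF e] unfolding continuous_at_eps_delta by blast
    define d where "d = min r (min d1 d2)"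
    define n where "n = norm v + norm w"
    define t where "t = d / (n + 1)"
    have n: "n \<ge> 0" by (simp add: n_def)
    have d: "d > 0" using r d1 d2 by (simp add: d_def)
    have t: "t > 0" using d n by (simp add: t_def)
    have tn: "t * n < d" using d n by (simp add: t_def divide_simps mult_pos_pos)
    obtain z1 where z1: "norm (z1 - x) \<le> t * n"
        "f (x + t *\<^sub>R v + t *\<^sub>R w) - f (x + t *\<^sub>R v) - f (x + t *\<^sub>R w) + f x = t * (t * H v w z1)"
      using second_difference_mean_value[OF f r(2) t, of v w] tn unfolding n_def H_def d_def by auto
    obtain z2 where z2: "norm (z2 - x) \<le> t * n"
        "f (x + t *\<^sub>R w + t *\<^sub>R v) - f (x + t *\<^sub>R w) - f (x + t *\<^sub>R v) + f x = t * (t * H w v z2)"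
      using second_difference_mean_value[OF f r(2) t, of w v] tn unfolding n_def H_def d_def by (auto simp: add.commute)
    have swap: "x + t *\<^sub>R w + t *\<^sub>R v = x + t *\<^sub>R v + t *\<^sub>R w" by (simp add: ac_simps)
    have "t * (t * H v w z1) = t * (t * H w v z2)" using z1(2) z2(2)[unfolded swap] by linarith
    then have "H v w z1 = H w v z2" using t by simp
    moreover have "\<bar>H v w z1 - H v w x\<bar> < e/2" using z1(1) tn using d1(2)[of z1] by (simp add: d_def dist_norm)
    moreover have "\<bar>H w v z2 - H w v x\<bar> < e/2" using z2(1) tn using d2(2)[of z2] by (simp add: d_def dist_norm)
    ultimately show ?thesis by linarith
  qed
  then have "\<bar>H v w x - H w v x\<bar> \<le> 0" by (rule field_le_epsilon) simp
  then show ?thesis by (simp add: H_def)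
qed

section \<open>The pulled-back metric and its divergence\<close>

text \<open>The identity behind \<open>div (e \<delta> - P) = - \<langle>\<tau>(u), du\<rangle>\<close> at one point, in coordinates. \<open>Y k i\<close> and \<open>Y2 k i a\<close> stand for
  the derivatives \<open>\<partial>\<^sub>i u\<^sup>k\<close> and \<open>\<partial>\<^sub>a \<partial>\<^sub>i u\<^sup>k\<close>, \<open>dg p k l\<close> for \<open>\<partial>\<^sub>p g\<^sub>k\<^sub>l\<close>, and \<open>DP a i j\<close> is the derivative
  \<open>\<partial>\<^sub>a P\<^sub>i\<^sub>j\<close> as given by the product and chain rules. The mixed second derivatives cancel by symmetry, and what
  remains of the derivatives of \<open>g\<close> is the Christoffel term of \<open>\<tau>\<close> with its index lowered.\<close>

lemma stress_divergence_algebra: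
  fixes g :: "'n::finite \<Rightarrow> 'n \<Rightarrow> real" and dg :: "'n \<Rightarrow> 'n \<Rightarrow> 'n \<Rightarrow> real"
    and Y :: "'n \<Rightarrow> 'm::finite \<Rightarrow> real" and Y2 :: "'n \<Rightarrow> 'm \<Rightarrow> 'm \<Rightarrow> real"
  assumes gsym: "\<And>k l. g k l = g l k" and dgsym: "\<And>p k l. dg p k l = dg p l k"
    and Y2sym: "\<And>k i j. Y2 k i j = Y2 k j i"
    and Gam: "\<And>k i j. (\<Sum>l\<in>UNIV. g k l * Gam l i j) = 1/2 * (dg i j k + dg j i k - dg k i j)"
    and tau: "\<And>l. (\<Sum>a\<in>UNIV. Y2 l a a + (\<Sum>i\<in>UNIV. \<Sum>j\<in>UNIV. Gam l i j * Y i a * Y j a)) = 1/2 * (\<Sum>j\<in>UNIV. X j * Y l j)"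
  defines "DP \<equiv> \<lambda>a i j. \<Sum>k\<in>UNIV. \<Sum>l\<in>UNIV. (\<Sum>p\<in>UNIV. dg p k l * Y p a) * Y k i * Y l j
       + g k l * (Y2 k i a * Y l j + Y k i * Y2 l j a)"
  shows "(\<Sum>j\<in>UNIV. DP j i j) - 1/2 * (\<Sum>j\<in>UNIV. DP i j j) =
    1/2 * (\<Sum>j\<in>UNIV. X j * (\<Sum>k\<in>UNIV. \<Sum>l\<in>UNIV. g k l * Y k i * Y l j))"
proof -
  define A where "A j = (\<Sum>k\<in>UNIV. \<Sum>l\<in>UNIV. \<Sum>p\<in>UNIV. dg p k l * Y p j * Y k i * Y l j)" for j
  define B where "B j = (\<Sum>k\<in>UNIV. \<Sum>l\<in>UNIV. \<Sum>p\<in>UNIV. dg p k l * Y p i * Y k j * Y l j)" for j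
  define Z where "Z j = (\<Sum>k\<in>UNIV. \<Sum>l\<in>UNIV. g k l * Y2 k i j * Y l j)" for j
  define V where "V j = (\<Sum>k\<in>UNIV. \<Sum>l\<in>UNIV. g k l * Y k i * Y2 l j j)" for j
  have D1: "DP j i j = A j + Z j + V j" for j
    by (simp add: DP_def A_def Z_def V_def sum.distrib sum_distrib_right sum_distrib_left algebra_simps)
  have D2: "DP i j j = B j + 2 * Z j" for j
  proof -
    have "(\<Sum>k\<in>UNIV. \<Sum>l\<in>UNIV. g k l * Y k j * Y2 l j i) = (\<Sum>l\<in>UNIV. \<Sum>k\<in>UNIV. g k l * Y k j * Y2 l j i)"
      by (rule sum.swap)
    also have "\<dots> = Z j"
      unfolding Z_def
    proof (intro sum.cong refl)
      fix l k show "g k l * Y k j * Y2 l j i = g l k * Y2 l i j * Y k j"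
        using gsym[of k l] Y2sym[of l j i] by simp
    qed
    finally have "(\<Sum>k\<in>UNIV. \<Sum>l\<in>UNIV. g k l * Y k j * Y2 l j i) = Z j" .
    moreover have "(\<Sum>k\<in>UNIV. \<Sum>l\<in>UNIV. g k l * Y2 k j i * Y l j) = Z j"
      unfolding Z_def by (simp only: Y2sym[of _ j i])
    moreover have "DP i j j = B j + (\<Sum>k\<in>UNIV. \<Sum>l\<in>UNIV. g k l * Y2 k j i * Y l j) + (\<Sum>k\<in>UNIV. \<Sum>l\<in>UNIV. g k l * Y k j * Y2 l j i)"
      by (simp add: DP_def B_def sum.distrib sum_distrib_right sum_distrib_left algebra_simps)
    ultimately show ?thesis by simp
  qed
  have chr: "(\<Sum>k\<in>UNIV. Y k i * (\<Sum>p\<in>UNIV. \<Sum>q\<in>UNIV. (1/2 * (dg p q k + dg q p k - dg k p q)) * Y p j * Y q j)) = A j - 1/2 * B j" for j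
  proof -
    have 1: "(\<Sum>k\<in>UNIV. \<Sum>p\<in>UNIV. \<Sum>q\<in>UNIV. dg p q k * Y p j * Y q j * Y k i) = A j"
      unfolding A_def
    proof (rule sum.cong[OF refl])
      fix k
      have "(\<Sum>p\<in>UNIV. \<Sum>q\<in>UNIV. dg p q k * Y p j * Y q j * Y k i) = (\<Sum>q\<in>UNIV. \<Sum>p\<in>UNIV. dg p q k * Y p j * Y q j * Y k i)"
        by (rule sum.swap)
      also have "\<dots> = (\<Sum>l\<in>UNIV. \<Sum>p\<in>UNIV. dg p k l * Y p j * Y k i * Y l j)"
      proof (intro sum.cong refl)
        fix q p show "dg p q k * Y p j * Y q j * Y k i = dg p k q * Y p j * Y k i * Y q j"
          using dgsym[of p q k] by simp
      qed
      finally show "(\<Sum>p\<in>UNIV. \<Sum>q\<in>UNIV. dg p q k * Y p j * Y q j * Y k i) = (\<Sum>l\<in>UNIV. \<Sum>p\<in>UNIV. dg p k l * Y p j * Y k i * Y l j)" .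
    qed
    have 2: "(\<Sum>k\<in>UNIV. \<Sum>p\<in>UNIV. \<Sum>q\<in>UNIV. dg q p k * Y p j * Y q j * Y k i) = A j"
      unfolding A_def
    proof (intro sum.cong refl)
      fix k p q show "dg q p k * Y p j * Y q j * Y k i = dg q k p * Y q j * Y k i * Y p j"
        using dgsym[of q p k] by simp
    qed
    have 3: "(\<Sum>k\<in>UNIV. \<Sum>p\<in>UNIV. \<Sum>q\<in>UNIV. dg k p q * Y p j * Y q j * Y k i) = B j"
    proof -
      have "(\<Sum>k\<in>UNIV. \<Sum>p\<in>UNIV. \<Sum>q\<in>UNIV. dg k p q * Y p j * Y q j * Y k i) =
         (\<Sum>p\<in>UNIV. \<Sum>k\<in>UNIV. \<Sum>q\<in>UNIV. dg k p q * Y p j * Y q j * Y k i)" by (rule sum.swap)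
      also have "\<dots> = (\<Sum>p\<in>UNIV. \<Sum>q\<in>UNIV. \<Sum>k\<in>UNIV. dg k p q * Y p j * Y q j * Y k i)"
        by (intro sum.cong refl sum.swap)
      finally show ?thesis by (simp add: B_def mult_ac)
    qed
    have "(\<Sum>k\<in>UNIV. Y k i * (\<Sum>p\<in>UNIV. \<Sum>q\<in>UNIV. (1/2 * (dg p q k + dg q p k - dg k p q)) * Y p j * Y q j)) =
       (\<Sum>k\<in>UNIV. \<Sum>p\<in>UNIV. \<Sum>q\<in>UNIV. 1/2 * (dg p q k * Y p j * Y q j * Y k i) + 1/2 * (dg q p k * Y p j * Y q j * Y k i)
         - 1/2 * (dg k p q * Y p j * Y q j * Y k i))"
      by (simp add: sum_distrib_left algebra_simps)
    also have "\<dots> = 1/2 * A j + 1/2 * A j - 1/2 * B j"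
      by (simp only: sum.distrib sum_subtractf sum_distrib_left[symmetric] 1 2 3)
    finally show ?thesis by simp
  qed
  have low: "(\<Sum>l\<in>UNIV. g k l * (\<Sum>a\<in>UNIV. Y2 l a a + (\<Sum>p\<in>UNIV. \<Sum>q\<in>UNIV. Gam l p q * Y p a * Y q a)))
    = (\<Sum>a\<in>UNIV. (\<Sum>l\<in>UNIV. g k l * Y2 l a a) + (\<Sum>p\<in>UNIV. \<Sum>q\<in>UNIV. (1/2 * (dg p q k + dg q p k - dg k p q)) * Y p a * Y q a))" for k
  proof -
    have "(\<Sum>l\<in>UNIV. g k l * (\<Sum>a\<in>UNIV. Y2 l a a + (\<Sum>p\<in>UNIV. \<Sum>q\<in>UNIV. Gam l p q * Y p a * Y q a)))
      = (\<Sum>l\<in>UNIV. \<Sum>a\<in>UNIV. g k l * Y2 l a a + (\<Sum>p\<in>UNIV. \<Sum>q\<in>UNIV. g k l * Gam l p q * Y p a * Y q a))"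
      by (simp add: sum_distrib_left distrib_left mult.assoc)
    also have "\<dots> = (\<Sum>a\<in>UNIV. \<Sum>l\<in>UNIV. g k l * Y2 l a a + (\<Sum>p\<in>UNIV. \<Sum>q\<in>UNIV. g k l * Gam l p q * Y p a * Y q a))"
      by (rule sum.swap)
    also have "\<dots> = (\<Sum>a\<in>UNIV. (\<Sum>l\<in>UNIV. g k l * Y2 l a a) + (\<Sum>p\<in>UNIV. \<Sum>q\<in>UNIV. (\<Sum>l\<in>UNIV. g k l * Gam l p q) * Y p a * Y q a))"
    proof (rule sum.cong[OF refl])
      fix a
      have "(\<Sum>l\<in>UNIV. \<Sum>p\<in>UNIV. \<Sum>q\<in>UNIV. g k l * Gam l p q * Y p a * Y q a)
        = (\<Sum>p\<in>UNIV. \<Sum>l\<in>UNIV. \<Sum>q\<in>UNIV. g k l * Gam l p q * Y p a * Y q a)" by (rule sum.swap)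
      also have "\<dots> = (\<Sum>p\<in>UNIV. \<Sum>q\<in>UNIV. \<Sum>l\<in>UNIV. g k l * Gam l p q * Y p a * Y q a)"
        by (intro sum.cong refl sum.swap)
      finally show "(\<Sum>l\<in>UNIV. g k l * Y2 l a a + (\<Sum>p\<in>UNIV. \<Sum>q\<in>UNIV. g k l * Gam l p q * Y p a * Y q a)) =
         (\<Sum>l\<in>UNIV. g k l * Y2 l a a) + (\<Sum>p\<in>UNIV. \<Sum>q\<in>UNIV. (\<Sum>l\<in>UNIV. g k l * Gam l p q) * Y p a * Y q a)"
        by (simp add: sum.distrib sum_distrib_right)
    qed
    finally show ?thesis by (simp only: Gam)
  qed
  have "1/2 * (\<Sum>j\<in>UNIV. X j * (\<Sum>k\<in>UNIV. \<Sum>l\<in>UNIV. g k l * Y k i * Y l j))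
     = (\<Sum>k\<in>UNIV. Y k i * (\<Sum>l\<in>UNIV. g k l * (1/2 * (\<Sum>j\<in>UNIV. X j * Y l j))))"
  proof -
    have "(\<Sum>j\<in>UNIV. X j * (\<Sum>k\<in>UNIV. \<Sum>l\<in>UNIV. g k l * Y k i * Y l j)) = (\<Sum>j\<in>UNIV. \<Sum>k\<in>UNIV. \<Sum>l\<in>UNIV. Y k i * (g k l * (X j * Y l j)))"
      by (simp add: sum_distrib_left mult_ac)
    also have "\<dots> = (\<Sum>k\<in>UNIV. \<Sum>j\<in>UNIV. \<Sum>l\<in>UNIV. Y k i * (g k l * (X j * Y l j)))" by (rule sum.swap)
    also have "\<dots> = (\<Sum>k\<in>UNIV. \<Sum>l\<in>UNIV. \<Sum>j\<in>UNIV. Y k i * (g k l * (X j * Y l j)))" by (intro sum.cong refl sum.swap)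
    finally show ?thesis by (simp add: sum_distrib_left mult_ac)
  qed
  also have "\<dots> = (\<Sum>k\<in>UNIV. Y k i * (\<Sum>l\<in>UNIV. g k l * (\<Sum>a\<in>UNIV. Y2 l a a + (\<Sum>p\<in>UNIV. \<Sum>q\<in>UNIV. Gam l p q * Y p a * Y q a))))"
    by (simp only: tau)
  also have "\<dots> = (\<Sum>k\<in>UNIV. \<Sum>a\<in>UNIV. Y k i * (\<Sum>l\<in>UNIV. g k l * Y2 l a a) + Y k i * (\<Sum>p\<in>UNIV. \<Sum>q\<in>UNIV. (1/2 * (dg p q k + dg q p k - dg k p q)) * Y p a * Y q a))"
    by (simp only: low sum_distrib_left[where r="Y _ i"] distrib_left)
  also have "\<dots> = (\<Sum>a\<in>UNIV. \<Sum>k\<in>UNIV. Y k i * (\<Sum>l\<in>UNIV. g k l * Y2 l a a) + Y k i * (\<Sum>p\<in>UNIV. \<Sum>q\<in>UNIV. (1/2 * (dg p q k + dg q p k - dg k p q)) * Y p a * Y q a))"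
    by (rule sum.swap)
  also have "\<dots> = (\<Sum>a\<in>UNIV. V a + (A a - 1/2 * B a))"
    by (intro sum.cong refl) (simp only: sum.distrib chr, simp add: V_def sum_distrib_left mult_ac)
  also have "\<dots> = (\<Sum>j\<in>UNIV. DP j i j) - 1/2 * (\<Sum>j\<in>UNIV. DP i j j)"
    by (simp add: D1 D2 sum.distrib sum_subtractf sum_distrib_left algebra_simps)
  finally show ?thesis by simp
qed

lemma metric_form_sum:
  "metric_form N c y v w = (\<Sum>k\<in>UNIV. \<Sum>l\<in>UNIV. metric N c y $ k $ l * v $ k * w $ l)"
  by (simp add: metric_form_def inner_vec_def matrix_vector_mult_def sum_distrib_left mult_ac)

lemma metric_form_add_left: "metric_form N c y (v + v') w = metric_form N c y v w + metric_form N c y v' w"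
  and metric_form_add_right: "metric_form N c y w (v + v') = metric_form N c y w v + metric_form N c y w v'"
  and metric_form_scale_left: "metric_form N c y (a *\<^sub>R v) w = a * metric_form N c y v w"
  and metric_form_scale_right: "metric_form N c y w (a *\<^sub>R v) = a * metric_form N c y w v"
  and metric_form_diff_left: "metric_form N c y (v - v') w = metric_form N c y v w - metric_form N c y v' w"
  and metric_form_diff_right: "metric_form N c y w (v - v') = metric_form N c y w v - metric_form N c y w v'"
  by (simp_all add: metric_form_def inner_add_left inner_add_right inner_diff_left inner_diff_right
      matrix_vector_right_distrib matrix_vector_mult_diff_distrib matrix_vector_mult_scaleR)

lemma metric_form_axis: "metric_form N c y (axis k 1) (axis l 1) = metric N c y $ k $ l"
  by (simp add: metric_form_def matrix_vector_mult_basis inner_axis' column_def)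

lemma riemannian_manifold_chart:
  assumes N: "riemannian_manifold N" and c: "c \<in> atlas N"
  shows "openin (space_top N) (fst c)" "open (snd c ` fst c)" "smooth_on (snd c ` fst c) (metric N c)"
    and "y \<in> snd c ` fst c \<Longrightarrow> metric_form N c y v w = metric_form N c y w v"
    and "y \<in> snd c ` fst c \<Longrightarrow> metric_form N c y v v \<ge> 0"
    and "y \<in> snd c ` fst c \<Longrightarrow> invertible (metric N c y)"
proof -
  show "openin (space_top N) (fst c)" "open (snd c ` fst c)" "smooth_on (snd c ` fst c) (metric N c)"
    using N c unfolding riemannian_manifold_def smooth_manifold_def by blast+
  assume y: "y \<in> snd c ` fst c"
  have sym: "\<forall>v w. metric_form N c y v w = metric_form N c y w v"
    and pos: "\<forall>v. v \<noteq> 0 \<longrightarrow> metric_form N c y v v > 0"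
    using N c y unfolding riemannian_manifold_def by blast+
  show "metric_form N c y v w = metric_form N c y w v" using sym by blast
  show "metric_form N c y v v \<ge> 0"
  proof (cases "v = 0")
    case True then show ?thesis by (simp add: metric_form_def)
  next
    case False then show ?thesis using pos by (simp add: less_imp_le)
  qed
  have "v = 0" if "metric N c y *v v = 0" for v
    using pos that by (force simp: metric_form_def)
  then show "invertible (metric N c y)"
    by (metis invertible_left_inverse matrix_left_invertible_ker)
qed

lemma smooth_map_chart:
  assumes N: "riemannian_manifold N" and u: "smooth_map N u" and c: "c \<in> atlas N"
  shows "open (u -` fst c)" "smooth_on (u -` fst c) (snd c \<circ> u)"
proof -
  have "openin euclidean {z \<in> topspace euclidean. u z \<in> fst c}"
    using u riemannian_manifold_chart(1)[OF N c] unfolding smooth_map_def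
    by (blast intro: openin_continuous_map_preimage)
  then show "open (u -` fst c)" by (simp add: vimage_def)
  show "smooth_on (u -` fst c) (snd c \<circ> u)" using u c unfolding smooth_map_def by blast
qed

lemma differential_linear:
  assumes "riemannian_manifold N" "smooth_map N u" "c \<in> atlas N" "u x \<in> fst c"
  shows "linear (differential c u x)"
proof -
  have "((snd c \<circ> u) has_derivative frechet_derivative (snd c \<circ> u) (at x)) (at x)"
    using smooth_map_chart(2)[OF assms(1-3)] assms(4) by (intro smooth_on_has_derivative) auto
  then show ?thesis unfolding differential_def[abs_def] by (rule has_derivative_linear)
qed

text \<open>The pairing \<open>\<langle>du(v), du(w)\<rangle>\<close>, obtained by polarisation from the squared norm, which does not depend on the
  chart; so it is globally defined, and \<open>pullback_metric_chart\<close> computes it in every chart around \<open>u x\<close>.\<close>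

definition pullback_metric :: "('p, 'n::finite) riem_data \<Rightarrow> (real^'m::finite \<Rightarrow> 'p) \<Rightarrow> real^'m \<Rightarrow> real^'m \<Rightarrow> real^'m \<Rightarrow> real"
  where "pullback_metric N u x v w =
    (sqnorm_differential N u x (v + w) - sqnorm_differential N u x (v - w)) / 4"

lemma pullback_metric_chart:
  assumes N: "riemannian_manifold N" and u: "smooth_map N u" and c: "c \<in> atlas N" "u x \<in> fst c"
  shows "pullback_metric N u x v w = metric_form N c (snd c (u x)) (differential c u x v) (differential c u x w)"
proof -
  let ?D = "differential c u x" and ?y = "snd c (u x)"
  note lin = differential_linear[OF N u c]
  have y: "?y \<in> snd c ` fst c" using c by blast
  show ?thesis
    unfolding pullback_metric_def sqnorm_differential_eq[OF N u c] linear_add[OF lin] linear_diff[OF lin]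
    by (simp add: metric_form_add_left metric_form_add_right metric_form_diff_left metric_form_diff_right
         riemannian_manifold_chart(4)[OF N c(1) y, of "?D w" "?D v"])
qed

lemma chart_exists:
  assumes "riemannian_manifold N" "smooth_map N u"
  obtains c where "c \<in> atlas N" "u x \<in> fst c"
proof -
  have "u x \<in> topspace (space_top N)"
    using assms(2) unfolding smooth_map_def by (metis UNIV_I continuous_map_image_subset_topspace image_subset_iff topspace_euclidean)
  moreover have "(\<Union>c\<in>atlas N. fst c) = topspace (space_top N)"
    using assms(1) unfolding riemannian_manifold_def smooth_manifold_def by blast
  ultimately show ?thesis using that by blast
qed

lemma pullback_metric:
  assumes N: "riemannian_manifold N" and u: "smooth_map N u"
  shows "sqnorm_differential N u x v = pullback_metric N u x v v"
    and "pullback_metric N u x v v \<ge> 0"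
    and "pullback_metric N u x v w = pullback_metric N u x w v"
    and "bilinear (pullback_metric N u x)"
proof -
  obtain c where c: "c \<in> atlas N" "u x \<in> fst c" using chart_exists[OF N u] .
  have y: "snd c (u x) \<in> snd c ` fst c" using c by blast
  note ch = pullback_metric_chart[OF N u c]
  note lin = differential_linear[OF N u c]
  show "sqnorm_differential N u x v = pullback_metric N u x v v"
    unfolding ch by (rule sqnorm_differential_eq[OF N u c])
  show "pullback_metric N u x v v \<ge> 0"
    unfolding ch by (rule riemannian_manifold_chart(5)[OF N c(1) y])
  show "pullback_metric N u x v w = pullback_metric N u x w v"
    unfolding ch by (rule riemannian_manifold_chart(4)[OF N c(1) y])
  show "bilinear (pullback_metric N u x)"
    unfolding bilinear_def ch[abs_def]
    by (intro allI conjI linearI)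
       (simp_all add: linear_add[OF lin] linear_scale[OF lin]
         metric_form_add_left metric_form_add_right metric_form_scale_left metric_form_scale_right)
qed

abbreviation pullback_component :: "('p, 'n::finite) riem_data \<Rightarrow> (real^'m::finite \<Rightarrow> 'p) \<Rightarrow> 'm \<Rightarrow> 'm \<Rightarrow> real^'m \<Rightarrow> real"
  where "pullback_component N u i j x \<equiv> pullback_metric N u x (axis i 1) (axis j 1)"

lemma frechet_derivative_partial_sum:
  fixes f :: "real^'m::finite \<Rightarrow> real"
  assumes "f differentiable (at x)"
  shows "frechet_derivative f (at x) v = (\<Sum>i\<in>UNIV. v $ i * partial_deriv i f x)"
proof -
  have lin: "linear (frechet_derivative f (at x))"
    by (rule linear_frechet_derivative[OF assms])
  have "v = (\<Sum>i\<in>UNIV. v $ i *\<^sub>R axis i 1)"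
    by (metis (no_types, lifting) basis_expansion scalar_mult_eq_scaleR sum.cong)
  then have "frechet_derivative f (at x) v = frechet_derivative f (at x) (\<Sum>i\<in>UNIV. v $ i *\<^sub>R axis i 1)" by simp
  also have "\<dots> = (\<Sum>i\<in>UNIV. v $ i * partial_deriv i f x)"
    by (simp add: linear_sum[OF lin] linear_scale[OF lin] partial_deriv_def)
  finally show ?thesis .
qed

lemma partial_deriv_chart:
  assumes N: "riemannian_manifold N" and u: "smooth_map N u" and c: "c \<in> atlas N" "u x \<in> fst c"
  shows "partial_deriv a (\<lambda>z. snd c (u z) $ k) x = differential c u x (axis a 1) $ k"
  using frechet_derivative_component(2)[OF smooth_on_differentiable[OF smooth_map_chart(2)[OF N u c(1)]], of x k] c(2)
  by (simp add: partial_deriv_def differential_def comp_def)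

text \<open>Product and chain rules for \<open>P\<^sub>i\<^sub>j = \<Sum> g\<^sub>k\<^sub>l(u) \<partial>\<^sub>i u\<^sup>k \<partial>\<^sub>j u\<^sup>l\<close> on the open set that \<open>u\<close> maps into the chart.\<close>

lemma pullback_component_derivative:
  fixes N :: "('p, 'n::finite) riem_data" and u :: "real^'m::finite \<Rightarrow> 'p"
  assumes N: "riemannian_manifold N" and u: "smooth_map N u" and c: "c \<in> atlas N"
  defines "Y \<equiv> \<lambda>k i. partial_deriv i (\<lambda>z. snd c (u z) $ k)"
  defines "g \<equiv> \<lambda>k l y. metric N c y $ k $ l"
  defines "D \<equiv> \<lambda>i j x v. \<Sum>k\<in>UNIV. \<Sum>l\<in>UNIV.
      frechet_derivative (g k l) (at (snd c (u x))) (differential c u x v) * Y k i x * Y l j x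
      + g k l (snd c (u x)) * (frechet_derivative (Y k i) (at x) v * Y l j x + Y k i x * frechet_derivative (Y l j) (at x) v)"
  shows "u x \<in> fst c \<Longrightarrow> pullback_component N u i j x = (\<Sum>k\<in>UNIV. \<Sum>l\<in>UNIV. g k l (snd c (u x)) * Y k i x * Y l j x)"
    and "u x \<in> fst c \<Longrightarrow> (pullback_component N u i j has_derivative D i j x) (at x)"
    and "continuous_on (u -` fst c) (\<lambda>x. D i j x v)"
proof -
  let ?U = "u -` fst c" and ?V = "snd c ` fst c"
  note U = smooth_map_chart[OF N u c] and V = riemannian_manifold_chart(2,3)[OF N c]
  have ys: "smooth_on ?U (\<lambda>z. snd c (u z) $ k)" for k
    using smooth_on_component[OF U] by (simp add: comp_def)
  have Ys: "smooth_on ?U (Y k i)" for k i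
    using smooth_on_frechet_derivative[OF ys] by (simp add: Y_def partial_deriv_def[abs_def])
  have gs: "smooth_on ?V (g k l)" for k l
    unfolding g_def by (intro smooth_on_component V)
  have chart: "pullback_component N u i j x = (\<Sum>k\<in>UNIV. \<Sum>l\<in>UNIV. g k l (snd c (u x)) * Y k i x * Y l j x)"
    if "u x \<in> fst c" for x
    unfolding pullback_metric_chart[OF N u c that] metric_form_sum g_def Y_def partial_deriv_chart[OF N u c that] ..
  then show "u x \<in> fst c \<Longrightarrow> pullback_component N u i j x = (\<Sum>k\<in>UNIV. \<Sum>l\<in>UNIV. g k l (snd c (u x)) * Y k i x * Y l j x)" .
  show "(pullback_component N u i j has_derivative D i j x) (at x)" if x: "u x \<in> fst c"
  proof (rule has_derivative_transform_within_open[OF _ U(1)])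
    have yd: "((\<lambda>z. snd c (u z)) has_derivative differential c u x) (at x)"
      using smooth_on_has_derivative[OF U(2), of x] x by (simp add: differential_def[abs_def] comp_def)
    have gd: "((\<lambda>z. g k l (snd c (u z))) has_derivative (\<lambda>v. frechet_derivative (g k l) (at (snd c (u x))) (differential c u x v))) (at x)" for k l
      by (rule has_derivative_compose[OF yd smooth_on_has_derivative[OF gs]]) (use x in blast)
    have Yd: "(Y k i has_derivative frechet_derivative (Y k i) (at x)) (at x)" for k i
      using smooth_on_has_derivative[OF Ys] x by simp
    have "((\<lambda>x. g k l (snd c (u x)) * Y k i x * Y l j x) has_derivative
       (\<lambda>v. frechet_derivative (g k l) (at (snd c (u x))) (differential c u x v) * Y k i x * Y l j x
        + g k l (snd c (u x)) * (frechet_derivative (Y k i) (at x) v * Y l j x + Y k i x * frechet_derivative (Y l j) (at x) v))) (at x)" for k l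
      by (rule has_derivative_eq_rhs[OF has_derivative_mult[OF has_derivative_mult[OF gd Yd] Yd]])
         (simp add: fun_eq_iff algebra_simps)
    then show "((\<lambda>x. \<Sum>k\<in>UNIV. \<Sum>l\<in>UNIV. g k l (snd c (u x)) * Y k i x * Y l j x) has_derivative D i j x) (at x)"
      unfolding D_def by (intro has_derivative_sum)
  qed (use x chart in auto)
  have yc: "continuous_on ?U (\<lambda>x. snd c (u x))"
    using smooth_on_continuous[OF U(2)] by (simp add: comp_def)
  have gc: "continuous_on ?U (\<lambda>x. g k l (snd c (u x)))" for k l
    by (rule continuous_on_compose2[OF smooth_on_continuous[OF gs] yc]) blast
  have Yc: "continuous_on ?U (Y k i)" "continuous_on ?U (\<lambda>x. frechet_derivative (Y k i) (at x) v)" for k i v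
    by (intro smooth_on_continuous smooth_on_frechet_derivative Ys)+
  have dgc: "continuous_on ?U (\<lambda>x. frechet_derivative (g k l) (at (snd c (u x))) (differential c u x v))" for k l v
  proof -
    have "continuous_on ?U (\<lambda>x. \<Sum>p\<in>UNIV. frechet_derivative (snd c \<circ> u) (at x) v $ p * partial_deriv p (g k l) (snd c (u x)))"
    proof (intro continuous_intros)
      show "continuous_on ?U (\<lambda>x. frechet_derivative (snd c \<circ> u) (at x) v)"
        by (intro smooth_on_continuous smooth_on_frechet_derivative U)
      show "continuous_on ?U (\<lambda>x. partial_deriv p (g k l) (snd c (u x)))" for p
        unfolding partial_deriv_def
        by (rule continuous_on_compose2[OF smooth_on_continuous[OF smooth_on_frechet_derivative[OF gs]] yc]) blast
    qed
    then show ?thesis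
      by (rule continuous_on_eq)
         (subst frechet_derivative_partial_sum[OF smooth_on_differentiable[OF gs]]; auto simp: differential_def)
  qed
  show "continuous_on (u -` fst c) (\<lambda>x. D i j x v)"
    unfolding D_def by (intro continuous_intros gc Yc dgc)
qed

lemma pullback_component_C1:
  assumes N: "riemannian_manifold N" and u: "smooth_map N u"
  shows "C_on 1 UNIV (pullback_component N u i j)"
proof -
  let ?f = "pullback_component N u i j"
  have "?f differentiable (at x) \<and> isCont (\<lambda>x. frechet_derivative ?f (at x) v) x" for x v
  proof -
    obtain c where c: "c \<in> atlas N" "u x \<in> fst c" using chart_exists[OF N u] .
    note D = pullback_component_derivative[OF N u c(1)]
    have "continuous_on (u -` fst c) (\<lambda>x. frechet_derivative ?f (at x) v)"
      by (rule continuous_on_eq[OF D(3)[where i=i and j=j and v=v]])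
         (subst frechet_derivative_at[OF D(2)[where i=i and j=j], symmetric], auto)
    then have "isCont (\<lambda>x. frechet_derivative ?f (at x) v) x"
      using smooth_map_chart(1)[OF N u c(1)] c(2) by (auto simp: continuous_on_eq_continuous_at)
    moreover have "?f differentiable (at x)"
      using D(2)[OF c(2)] unfolding differentiable_def by blast
    ultimately show ?thesis by blast
  qed
  then show ?thesis by (simp add: continuous_at_imp_continuous_on)
qed

text \<open>The left side is minus the divergence of the stress-energy tensor \<open>e \<delta>\<^sub>i\<^sub>j - P\<^sub>i\<^sub>j\<close>; in a chart it equals
  \<open>\<langle>\<tau>(u), \<partial>\<^sub>i u\<rangle>\<close> by \<open>stress_divergence_algebra\<close>, which the equation for \<open>\<tau>(u)\<close> evaluates.\<close>

lemma pullback_metric_divergence: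
  fixes N :: "('p, 'n::finite) riem_data" and u :: "real^'m::finite \<Rightarrow> 'p"
  assumes N: "riemannian_manifold N" and u: "smooth_map N u"
    and tau: "\<And>c. c \<in> atlas N \<Longrightarrow> u x \<in> fst c \<Longrightarrow> tension_field N c u x = (1/2) *\<^sub>R differential c u x x"
  shows "(\<Sum>j\<in>UNIV. partial_deriv j (pullback_component N u i j) x)
     - 1/2 * (\<Sum>j\<in>UNIV. partial_deriv i (pullback_component N u j j) x)
     = 1/2 * (\<Sum>j\<in>UNIV. x $ j * pullback_component N u i j x)"
proof -
  obtain c where c: "c \<in> atlas N" "u x \<in> fst c" using chart_exists[OF N u] .
  define y where "y = snd c (u x)"
  define g where "g k l = metric N c y $ k $ l" for k l
  define dg where "dg p k l = partial_deriv p (\<lambda>z. metric N c z $ k $ l) y" for p k l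
  define Y where "Y k i = partial_deriv i (\<lambda>z. snd c (u z) $ k) x" for k i
  define Y2 where "Y2 k i a = partial_deriv a (partial_deriv i (\<lambda>z. snd c (u z) $ k)) x" for k i a
  have y: "y \<in> snd c ` fst c" using c by (simp add: y_def)
  have x: "x \<in> u -` fst c" using c by simp
  note V = riemannian_manifold_chart[OF N c(1)] and U = smooth_map_chart[OF N u c(1)]
  have gs: "smooth_on (snd c ` fst c) (\<lambda>z. metric N c z $ k $ l)" for k l
    by (intro smooth_on_component V)
  have ys: "smooth_on (u -` fst c) (\<lambda>z. snd c (u z) $ k)" for k
    using smooth_on_component[OF U] by (simp add: comp_def)
  have gsym': "metric N c z $ k $ l = metric N c z $ l $ k" if "z \<in> snd c ` fst c" for z k l
    using V(4)[OF that, of "axis k 1" "axis l 1"]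
    by (simp add: metric_form_axis)
  have gsym: "g k l = g l k" for k l using gsym'[OF y] by (simp add: g_def)
  have dgsym: "dg p k l = dg p l k" for p k l
    unfolding dg_def partial_deriv_def
    by (subst frechet_derivative_cong_open[OF V(2) y, of _ "\<lambda>z. metric N c z $ l $ k"]) (auto simp: gsym')
  have Y2sym: "Y2 k i j = Y2 k j i" for k i j
    unfolding Y2_def partial_deriv_def by (rule second_derivative_symmetric[OF U(1) x ys])
  have Gam: "(\<Sum>l\<in>UNIV. g k l * christoffel N c l i j y) = 1/2 * (dg i j k + dg j i k - dg k i j)" for k i j
  proof -
    have inv: "(\<Sum>l\<in>UNIV. g k l * matrix_inv (metric N c y) $ l $ r) = (if k = r then 1 else 0)" for r
    proof -
      have "(metric N c y ** matrix_inv (metric N c y)) $ k $ r = (if k = r then 1 else 0)"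
        using someI_ex[OF V(6)[OF y, unfolded invertible_def]] by (simp add: matrix_inv_def mat_def)
      then show ?thesis by (simp add: matrix_matrix_mult_def g_def)
    qed
    have "(\<Sum>l\<in>UNIV. g k l * christoffel N c l i j y) =
      (\<Sum>l\<in>UNIV. \<Sum>r\<in>UNIV. 1/2 * ((g k l * matrix_inv (metric N c y) $ l $ r) * (dg i j r + dg j i r - dg r i j)))"
      by (simp add: christoffel_def dg_def sum_distrib_left mult_ac)
    also have "\<dots> = (\<Sum>r\<in>UNIV. \<Sum>l\<in>UNIV. 1/2 * ((g k l * matrix_inv (metric N c y) $ l $ r) * (dg i j r + dg j i r - dg r i j)))"
      by (rule sum.swap)
    also have "\<dots> = (\<Sum>r\<in>UNIV. 1/2 * ((if k = r then 1 else 0) * (dg i j r + dg j i r - dg r i j)))"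
      by (simp only: sum_distrib_left[symmetric] sum_distrib_right[symmetric] inv)
    also have "\<dots> = 1/2 * (dg i j k + dg j i k - dg k i j)"
    proof -
      have "1/2 * ((if k = r then 1 else 0) * (dg i j r + dg j i r - dg r i j)) = (if k = r then 1/2 * (dg i j r + dg j i r - dg r i j) else 0)" for r
        by simp
      then show ?thesis by (simp only: sum.delta'[OF finite] UNIV_I if_True)
    qed
    finally show ?thesis .
  qed
  have tau': "(\<Sum>a\<in>UNIV. Y2 l a a + (\<Sum>i\<in>UNIV. \<Sum>j\<in>UNIV. christoffel N c l i j y * Y i a * Y j a)) = 1/2 * (\<Sum>j\<in>UNIV. x $ j * Y l j)" for l
  proof -
    have "(\<Sum>a\<in>UNIV. Y2 l a a + (\<Sum>i\<in>UNIV. \<Sum>j\<in>UNIV. christoffel N c l i j y * Y i a * Y j a)) = tension_field N c u x $ l"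
      by (simp add: tension_field_def Y2_def Y_def y_def)
    also have "\<dots> = 1/2 * (differential c u x x $ l)" using tau[OF c] by simp
    also have "differential c u x x $ l = frechet_derivative (\<lambda>z. snd c (u z) $ l) (at x) x"
      using frechet_derivative_component(2)[OF smooth_on_differentiable[OF U(2) x], of l x]
      by (simp add: differential_def comp_def)
    also have "\<dots> = (\<Sum>j\<in>UNIV. x $ j * Y l j)"
      unfolding Y_def by (rule frechet_derivative_partial_sum[OF smooth_on_differentiable[OF ys x]])
    finally show ?thesis .
  qed
  note alg = stress_divergence_algebra[where g=g and dg=dg and Y=Y and ?Y2.0=Y2 and Gam="\<lambda>k i j. christoffel N c k i j y" and X="\<lambda>j. x $ j",
     OF gsym dgsym Y2sym Gam tau', of i]
  note D = pullback_component_derivative(1,2)[OF N u c]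
  have P: "pullback_component N u i j x = (\<Sum>k\<in>UNIV. \<Sum>l\<in>UNIV. g k l * Y k i * Y l j)" for i j
    using D(1)[of i j] by (simp add: g_def Y_def y_def)
  have DP: "partial_deriv a (pullback_component N u i j) x = (\<Sum>k\<in>UNIV. \<Sum>l\<in>UNIV. (\<Sum>p\<in>UNIV. dg p k l * Y p a) * Y k i * Y l j
       + g k l * (Y2 k i a * Y l j + Y k i * Y2 l j a))" for a i j
  proof -
    have "frechet_derivative (\<lambda>z. metric N c z $ k $ l) (at y) (differential c u x (axis a 1)) = (\<Sum>p\<in>UNIV. dg p k l * Y p a)" for k l
      using frechet_derivative_partial_sum[OF smooth_on_differentiable[OF gs y], of k l "differential c u x (axis a 1)"]
      by (simp add: dg_def Y_def partial_deriv_chart[OF N u c] mult.commute)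
    then show ?thesis
      using fun_cong[OF frechet_derivative_at[OF D(2)[of i j]], of "axis a 1"]
      by (simp add: partial_deriv_def[of a "pullback_component N u i j"] g_def Y_def Y2_def y_def partial_deriv_def[of a "partial_deriv _ _"])
  qed
  show ?thesis unfolding P DP by (rule alg)
qed

lemma sum_Basis_vec: "(\<Sum>b\<in>(Basis :: (real^'m::finite) set). f b) = (\<Sum>j\<in>UNIV. f (axis j 1))"
proof -
  have B: "(Basis :: (real^'m) set) = range (\<lambda>j. axis j 1)" by (auto simp: Basis_vec_def)
  have inj: "inj (\<lambda>j::'m. axis j (1::real))" by (auto simp: inj_on_def axis_eq_axis)
  show ?thesis unfolding B sum.reindex[OF inj] by (simp add: comp_def)
qed

lemma bilinear_axis_expansion:
  fixes P :: "real^'m::finite \<Rightarrow> real^'m \<Rightarrow> real"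
  assumes bil: "bilinear P"
  shows "P x y = (\<Sum>i\<in>UNIV. \<Sum>j\<in>UNIV. x $ i * y $ j * P (axis i 1) (axis j 1))"
proof -
  have x: "x = (\<Sum>i\<in>UNIV. x $ i *\<^sub>R axis i 1)" for x :: "real^'m"
    by (metis (no_types, lifting) basis_expansion scalar_mult_eq_scaleR sum.cong)
  have "P (\<Sum>i\<in>UNIV. x $ i *\<^sub>R axis i 1) (\<Sum>i\<in>UNIV. y $ i *\<^sub>R axis i 1)
     = (\<Sum>i\<in>UNIV. \<Sum>j\<in>UNIV. P (x $ i *\<^sub>R axis i 1) (y $ j *\<^sub>R axis j 1))"
    by (simp only: bilinear_sum[OF bil] sum.cartesian_product)
  then show ?thesis
    by (simp only: x[symmetric] bilinear_lmul[OF bil] bilinear_rmul[OF bil] real_scaleR_def mult_ac)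
qed

text \<open>Lagrange's identity: the difference of the two sides is half the sum of
  \<open>P(x\<^sub>i a\<^sub>j - x\<^sub>j a\<^sub>i, x\<^sub>i a\<^sub>j - x\<^sub>j a\<^sub>i)\<close> over all \<open>i\<close>, \<open>j\<close>, where \<open>a\<^sub>i\<close> are the unit coordinate vectors.\<close>

lemma bilinear_cauchy_schwarz_trace:
  fixes P :: "real^'m::finite \<Rightarrow> real^'m \<Rightarrow> real"
  assumes bil: "bilinear P" and sym: "\<And>v w. P v w = P w v" and nonneg: "\<And>v. P v v \<ge> 0"
  shows "P x x \<le> (norm x)\<^sup>2 * (\<Sum>j\<in>UNIV. P (axis j 1) (axis j 1))"
proof -
  let ?a = "\<lambda>j. axis j 1 :: real^'m"
  note Px = bilinear_axis_expansion[OF bil, of x x]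
  have n: "(norm x)\<^sup>2 = (\<Sum>i\<in>UNIV. x $ i * x $ i)"
    by (simp add: power2_norm_eq_inner inner_vec_def)
  have "0 \<le> (\<Sum>i\<in>UNIV. \<Sum>j\<in>UNIV. P (x $ i *\<^sub>R ?a j - x $ j *\<^sub>R ?a i) (x $ i *\<^sub>R ?a j - x $ j *\<^sub>R ?a i))"
    by (intro sum_nonneg nonneg)
  also have "\<dots> = (\<Sum>i\<in>UNIV. \<Sum>j\<in>UNIV. (x $ i * x $ i) * P (?a j) (?a j) + (x $ j * x $ j) * P (?a i) (?a i)
      - 2 * (x $ i * x $ j * P (?a i) (?a j)))"
    by (intro sum.cong refl)
       (simp add: bilinear_lsub[OF bil] bilinear_rsub[OF bil] bilinear_lmul[OF bil] bilinear_rmul[OF bil] sym[of "?a _" "?a _"] algebra_simps)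
  also have "\<dots> = 2 * ((norm x)\<^sup>2 * (\<Sum>j\<in>UNIV. P (?a j) (?a j))) - 2 * P x x"
  proof -
    have 1: "(\<Sum>i\<in>UNIV. \<Sum>j\<in>UNIV. (x $ i * x $ i) * P (?a j) (?a j)) = (norm x)\<^sup>2 * (\<Sum>j\<in>UNIV. P (?a j) (?a j))"
      unfolding n by (rule sum_product[symmetric])
    have 2: "(\<Sum>i\<in>UNIV. \<Sum>j\<in>UNIV. (x $ j * x $ j) * P (?a i) (?a i)) = (norm x)\<^sup>2 * (\<Sum>j\<in>UNIV. P (?a j) (?a j))"
      unfolding 1[symmetric] by (rule sum.swap)
    show ?thesis by (simp only: sum.distrib sum_subtractf 1 2) (simp add: Px sum_distrib_left)
  qed
  finally show ?thesis by simp
qed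


section \<open>The equivalence of the three conditions\<close>

theorem theorem1p1:
  fixes N :: "('p, 'n::finite) riem_data"
    and u :: "real^'m::finite \<Rightarrow> 'p"
  assumes "CARD('m) > 2"
    and "riemannian_manifold N"
    and "smooth_map N u"
    and "\<And>x c. c \<in> atlas N \<Longrightarrow> u x \<in> fst c \<Longrightarrow>
           tension_field N c u x = (1/2) *\<^sub>R differential c u x x"
  shows "(((\<lambda>R::real. R ^ CARD('m) * exp (- R\<^sup>2 / 4) *
             (LINT x:ball 0 R|lborel. energy_density N u x * exp (- (norm x)\<^sup>2 / 4))) \<longlongrightarrow> 0) at_top
           \<longleftrightarrow> (\<integral>\<^sup>+ x. ennreal (sqnorm_radial N u x * norm x powi (4 - int CARD('m))) \<partial>lborel) < \<infinity>)
       \<and> ((\<integral>\<^sup>+ x. ennreal (sqnorm_radial N u x * norm x powi (4 - int CARD('m))) \<partial>lborel) < \<infinity>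
           \<longleftrightarrow> (\<integral>\<^sup>+ x. ennreal (energy_density N u x * exp (- (norm x)\<^sup>2 / 4)) \<partial>lborel) < \<infinity>)"
proof -
  note N = assms(2) and u = assms(3) and tau = assms(4)
  define P where "P i j x = pullback_component N u i j x" for i j x
  define dP where "dP i j x v = frechet_derivative (P i j) (at x) v" for i j x v
  define e where "e = energy_density N u"
  define beta where "beta x = pullback_metric N u x x x" for x
  \<comment> \<open>The stress-energy tensor applied to the position vector.\<close>
  define W where "W x = (\<chi> j. e x * x $ j - (\<Sum>i\<in>UNIV. P i j x * x $ i))" for x
  define de where "de x v = 1/2 * (\<Sum>j\<in>UNIV. dP j j x v)" for x v
  have Peq: "P i j = pullback_component N u i j" for i j by (simp add: P_def[abs_def])
  have PC: "C_on 1 UNIV (P i j)" for i j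
    unfolding Peq by (rule pullback_component_C1[OF N u])
  have Pd: "(P i j has_derivative dP i j x) (at x)" for i j x
    using C1_has_derivative[OF PC] by (simp add: dP_def[abs_def])
  have dPc: "continuous_on UNIV (\<lambda>x. dP i j x v)" for i j v
    unfolding dP_def by (intro C1_derivative_continuous[OF PC] continuous_intros)
  have Psym: "P i j = P j i" for i j
    by (simp add: P_def fun_eq_iff pullback_metric(3)[OF N u, of _ "axis i 1"])
  have e_eq: "e x = 1/2 * (\<Sum>j\<in>UNIV. P j j x)" for x
    by (simp add: e_def energy_density_def pullback_metric(1)[OF N u] P_def)
  have bil: "bilinear (pullback_metric N u x)" for x by (rule pullback_metric(4)[OF N u])
  have beta_eq: "beta x = (\<Sum>i\<in>UNIV. \<Sum>j\<in>UNIV. x $ i * x $ j * P i j x)" for x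
    unfolding beta_def P_def by (rule bilinear_axis_expansion[OF bil])
  have ed: "(e has_derivative de x) (at x)" for x
    unfolding e_eq[abs_def] de_def by (intro has_derivative_mult_right has_derivative_sum Pd)
  have dec: "continuous_on UNIV (\<lambda>x. de x v)" for v
    unfolding de_def by (intro continuous_intros dPc)
  have eC: "C_on 1 UNIV e" using C1I(1)[OF ed dec] .
  have enn: "e x \<ge> 0" for x
    unfolding e_eq P_def by (intro mult_nonneg_nonneg sum_nonneg pullback_metric(2)[OF N u]) simp
  have coordd: "((\<lambda>x::real^'m. x $ i) has_derivative (\<lambda>v. v $ i)) (at x)" for i x
    by (rule bounded_linear_imp_has_derivative[OF bounded_linear_vec_nth])
  have betad: "(beta has_derivative (\<lambda>v. \<Sum>i\<in>UNIV. \<Sum>j\<in>UNIV. (x $ i * x $ j) * dP i j x v + (x $ i * v $ j + v $ i * x $ j) * P i j x)) (at x)" for x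
    unfolding beta_eq[abs_def] by (intro has_derivative_sum has_derivative_mult coordd Pd)
  have betaC: "C_on 1 UNIV beta"
    by (rule C1I(1)[OF betad]) (intro continuous_intros dPc C1_continuous[OF PC])
  have betann: "beta x \<ge> 0" for x unfolding beta_def by (rule pullback_metric(2)[OF N u])
  have le: "beta x \<le> 2 * (norm x)\<^sup>2 * e x" for x
    using bilinear_cauchy_schwarz_trace[OF bil pullback_metric(3)[OF N u] pullback_metric(2)[OF N u], of x x]
    by (simp add: beta_def e_eq P_def)
  define dW where "dW j x v = (e x * v $ j + de x v * x $ j) - (\<Sum>i\<in>UNIV. P i j x * v $ i + dP i j x v * x $ i)" for j x v
  have Wd: "((\<lambda>x. W x \<bullet> axis j 1) has_derivative dW j x) (at x)" for j x
    unfolding W_def dW_def inner_axis by simp (intro has_derivative_diff has_derivative_sum has_derivative_mult coordd Pd ed)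
  have dWc: "continuous_on UNIV (\<lambda>x. dW j x v)" for j v
    unfolding dW_def by (intro continuous_intros dPc dec C1_continuous[OF PC] C1_continuous[OF eC])
  have WC: "C_on 1 UNIV (\<lambda>x. W x \<bullet> b)" if b: "b \<in> Basis" for b
  proof -
    obtain j where "b = axis j 1" using b by (auto simp: Basis_vec_def)
    then show ?thesis using C1I(1)[OF Wd dWc] by simp
  qed
  have div: "(\<Sum>b\<in>Basis. frechet_derivative (\<lambda>x. W x \<bullet> b) (at x) b) = (real DIM(real^'m) - 2) * e x - beta x / 2" for x
  proof -
    have "(\<Sum>b\<in>Basis. frechet_derivative (\<lambda>x. W x \<bullet> b) (at x) b) = (\<Sum>j\<in>UNIV. dW j x (axis j 1))"
      unfolding sum_Basis_vec by (simp only: C1I(2)[OF Wd dWc])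
    also have "\<dots> = (\<Sum>j\<in>UNIV. e x + de x (axis j 1) * x $ j - P j j x - (\<Sum>i\<in>UNIV. dP i j x (axis j 1) * x $ i))"
    proof (rule sum.cong[OF refl])
      fix j
      have "(\<Sum>i\<in>UNIV. P i j x * axis j 1 $ i) = P j j x"
        by (simp add: axis_def if_distrib cong: if_cong)
      then show "dW j x (axis j 1) = e x + de x (axis j 1) * x $ j - P j j x - (\<Sum>i\<in>UNIV. dP i j x (axis j 1) * x $ i)"
        by (simp add: dW_def sum.distrib)
    qed
    also have "\<dots> = (real CARD('m) - 2) * e x + ((\<Sum>j\<in>UNIV. de x (axis j 1) * x $ j) - (\<Sum>j\<in>UNIV. \<Sum>i\<in>UNIV. dP i j x (axis j 1) * x $ i))"
    proof -
      have "(\<Sum>j\<in>UNIV. P j j x) = 2 * e x" by (simp add: e_eq)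
      then show ?thesis by (simp add: sum.distrib sum_subtractf algebra_simps)
    qed
    also have "(\<Sum>j\<in>UNIV. \<Sum>i\<in>UNIV. dP i j x (axis j 1) * x $ i) = (\<Sum>i\<in>UNIV. \<Sum>j\<in>UNIV. dP i j x (axis j 1) * x $ i)"
      by (rule sum.swap)
    also have "(\<Sum>j\<in>UNIV. de x (axis j 1) * x $ j) - \<dots> = (\<Sum>i\<in>UNIV. - x $ i * ((\<Sum>j\<in>UNIV. dP i j x (axis j 1)) - 1/2 * (\<Sum>j\<in>UNIV. dP j j x (axis i 1))))"
      by (simp add: de_def sum_subtractf[symmetric] sum_distrib_left algebra_simps)
    also have "\<dots> = (\<Sum>i\<in>UNIV. - x $ i * (1/2 * (\<Sum>j\<in>UNIV. x $ j * P i j x)))"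
    proof -
      have dv: "(\<Sum>j\<in>UNIV. dP i j x (axis j 1)) - 1/2 * (\<Sum>j\<in>UNIV. dP j j x (axis i 1)) = 1/2 * (\<Sum>j\<in>UNIV. x $ j * P i j x)" for i
        using pullback_metric_divergence[OF N u tau, of x i] unfolding dP_def partial_deriv_def Peq .
      show ?thesis by (simp only: dv)
    qed
    also have "\<dots> = - beta x / 2"
      by (simp add: beta_eq sum_distrib_left sum_negf sum_divide_distrib mult_ac)
    finally show ?thesis by simp
  qed
  have flux: "x \<bullet> W x = (norm x)\<^sup>2 * e x - beta x" for x
  proof -
    have "x \<bullet> W x = (\<Sum>j\<in>UNIV. e x * (x $ j * x $ j)) - (\<Sum>j\<in>UNIV. \<Sum>i\<in>UNIV. x $ j * x $ i * P j i x)"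
      by (simp add: inner_vec_def W_def sum_subtractf[symmetric] sum_distrib_left algebra_simps Psym)
    also have "\<dots> = (norm x)\<^sup>2 * e x - beta x"
      by (simp add: beta_eq power2_norm_eq_inner inner_vec_def sum_distrib_left[symmetric])
    finally show ?thesis .
  qed
  \<comment> \<open>At the origin both sides vanish, the left one because \<open>sgn 0 = 0\<close>.\<close>
  have rad: "sqnorm_radial N u x * norm x powi (4 - int CARD('m)) = beta x * norm x powi (2 - int DIM(real^'m))" for x
  proof (cases "x = 0")
    case True
    then show ?thesis
      using bilinear_lzero[OF bil] by (simp add: sqnorm_radial_def beta_def pullback_metric(1)[OF N u])
  next
    case False
    have "sqnorm_radial N u x = beta x / (norm x)\<^sup>2"
      unfolding sqnorm_radial_def pullback_metric(1)[OF N u] sgn_div_norm beta_def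
      by (simp add: bilinear_lmul[OF bil] bilinear_rmul[OF bil] power2_eq_square divide_simps)
    moreover have "norm x powi (4 - int CARD('m)) = (norm x)\<^sup>2 * norm x powi (2 - int CARD('m))"
      using False power_int_add[of "norm x" 2 "2 - int CARD('m)"] by simp
    ultimately show ?thesis using False by simp
  qed
  show ?thesis
    using energy_equivalence[OF _ eC enn betaC betann le WC div flux] assms(1)
    unfolding rad by (simp add: e_def)
qed

end
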